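(* Let $K$ be a field of characteristic zero, $R=K[X_1,\ldots,X_n]$ with its standard grading, and $A_n(K)$ the $n$-th Weyl algebra over $K$, graded by $\deg X_i=1$, $\deg\partial_i=-1$. For a graded left $A_n(K)$-module $M$ let $M^{\vee}={}^*\operatorname{Hom}_K(M,K)$ denote its graded Matlis dual. If $M$ is a strongly generalized Eulerian $A_n(K)$-module, then so is $M(-n)^{\vee}$.
   Context: Let $\mathcal{E}_n=\sum_{i=1}^n X_i\partial_i\in A_n(K)$, and for a nonzero homogeneous element $w$ of a graded module write $|w|=\deg w$. A graded left $A_n(K)$-module $W$ is strongly generalized Eulerian if there exists an integer $a>0$, independent of $w$, such that $(\mathcal{E}_n-|w|)^a w=0$ for all homogeneous $w\in W$. The shift $M(k)$ has graded pieces $M(k)_i=M_{k+i}$. The graded $K$-dual $M^{\vee}={}^*\operatorname{Hom}_K(M,K)=\bigoplus_{i\in\mathbb{Z}}(M^\vee)_i$ has $(M^{\vee})_i=\operatorname{Hom}_K(M_{-i},K)$. Thus $M(-n)^\vee$ means $(M(-n))^\vee$, with $(M(-n)^{\vee})_i=\operatorname{Hom}_K(M_{-n-i},K)$. Let $\tau:A_n(K)\to A_n(K)$ be the standard transposition, $\tau(h\partial^{\alpha})=(-1)^{|\alpha|}\partial^{\alpha}h$ for $h\in R$, $\alpha\in\mathbb{N}^n$ (it satisfies $\tau(ab)=\tau(b)\tau(a)$ and $\tau^2=\mathrm{id}$). The left $A_n(K)$-module structure on $M^\vee$ is $(a\cdot\varphi)(m)=\varphi(\tau(a)\cdot m)$;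 i.e. it extends the natural $R$-module structure $(r\varphi)(m)=\varphi(rm)$ by $(\partial_i\cdot\varphi)(m)=\varphi(\tau(\partial_i)\cdot m)=-\varphi(\partial_i m)$. *)

theory Defs
  imports "HOL-Algebra.Module" "HOL-Algebra.AbelCoset" "HOL-Library.Poly_Mapping" "HOL-Library.Cardinality"
begin

section \<open>The Weyl algebra\<close>

text \<open>
  The variables of the polynomial ring \<open>R = K[X_1, ..., X_n]\<close> are indexed by a finite type
  \<open>'n\<close>, so that \<open>n = CARD('n)\<close>.  Exponent vectors have type \<open>'n \<Rightarrow>\<^sub>0 nat\<close>, and
  \<open>single \<alpha> c\<close> is the monomial \<open>c X^\<alpha>\<close>.
\<close>

type_synonym 'n expo = "'n \<Rightarrow>\<^sub>0 nat"
type_synonym ('n, 'k) mpoly = "'n expo \<Rightarrow>\<^sub>0 'k"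

definition expo_deg :: "'n::finite expo \<Rightarrow> nat" where
  "expo_deg \<alpha> = (\<Sum>i\<in>UNIV. Poly_Mapping.lookup \<alpha> i)"

definition const :: "'k::field_char_0 \<Rightarrow> ('n::finite, 'k) mpoly" where
  "const c = Poly_Mapping.single 0 c"

definition var :: "'n::finite \<Rightarrow> ('n, 'k::field_char_0) mpoly" where
  "var i = Poly_Mapping.single (Poly_Mapping.single i 1) 1"

definition partial :: "'n::finite \<Rightarrow> ('n, 'k::field_char_0) mpoly \<Rightarrow> ('n, 'k) mpoly" where
  "partial i f = (\<Sum>\<alpha>\<in>Poly_Mapping.keys f.
     Poly_Mapping.single (\<alpha> - Poly_Mapping.single i 1) (of_nat (Poly_Mapping.lookup \<alpha> i) * Poly_Mapping.lookup f \<alpha>))"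

text \<open>
  \<open>partials \<alpha>\<close> is \<open>\<partial>^\<alpha>\<close>; as the \<open>\<partial>_i\<close> commute, the order of composition in the fold is
  immaterial.
\<close>

definition partials :: "'n::finite expo \<Rightarrow> ('n, 'k::field_char_0) mpoly \<Rightarrow> ('n, 'k) mpoly" where
  "partials \<alpha> = Finite_Set.fold (\<lambda>i g. (partial i ^^ Poly_Mapping.lookup \<alpha> i) \<circ> g) id UNIV"

text \<open>
  Since \<open>K\<close> has characteristic zero, \<open>A_n(K)\<close> is the \<open>K\<close>-subalgebra of \<open>End_K(R)\<close> generated by
  the multiplications by \<open>X_i\<close> and by the \<open>\<partial>_i\<close>.
\<close>

inductive_set weyl_carrier :: "(('n::finite, 'k::field_char_0) mpoly \<Rightarrow> ('n, 'k) mpoly) set" where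
  const: "(\<lambda>f. const c * f) \<in> weyl_carrier"
| var: "(\<lambda>f. var i * f) \<in> weyl_carrier"
| partial: "partial i \<in> weyl_carrier"
| add: "\<lbrakk>a \<in> weyl_carrier; b \<in> weyl_carrier\<rbrakk> \<Longrightarrow> (\<lambda>f. a f + b f) \<in> weyl_carrier"
| comp: "\<lbrakk>a \<in> weyl_carrier; b \<in> weyl_carrier\<rbrakk> \<Longrightarrow> a \<circ> b \<in> weyl_carrier"

definition weyl :: "(('n::finite, 'k::field_char_0) mpoly \<Rightarrow> ('n, 'k) mpoly) ring" where
  "weyl = \<lparr>carrier = weyl_carrier, mult = (\<circ>), one = id,
           zero = (\<lambda>f. 0), add = (\<lambda>a b f. a f + b f)\<rparr>"

text \<open>The degree \<open>d\<close> part of the grading with \<open>deg X_i = 1\<close> and \<open>deg \<partial>_i = -1\<close>.\<close>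

definition weyl_component ::
    "int \<Rightarrow> (('n::finite, 'k::field_char_0) mpoly \<Rightarrow> ('n, 'k) mpoly) set" where
  "weyl_component d =
     {(\<lambda>f. \<Sum>(\<alpha>, \<beta>)\<in>S. Poly_Mapping.single \<alpha> (c \<alpha> \<beta>) * partials \<beta> f) | S c.
        finite S \<and> (\<forall>(\<alpha>, \<beta>)\<in>S. int (expo_deg \<alpha>) - int (expo_deg \<beta>) = d)}"

definition scalar :: "'k::field_char_0 \<Rightarrow> ('n::finite, 'k) mpoly \<Rightarrow> ('n, 'k) mpoly" where
  "scalar c = (\<lambda>f. const c * f)"

definition euler :: "('n::finite, 'k::field_char_0) mpoly \<Rightarrow> ('n, 'k) mpoly" where
  "euler = (\<lambda>f. \<Sum>i\<in>UNIV. var i * partial i f)"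

text \<open>
  \<open>diff_op h\<close> is \<open>\<Sum>\<^sub>\<alpha> h\<^sub>\<alpha> \<partial>^\<alpha>\<close>.  Each element of \<open>A_n(K)\<close> has exactly one such form (see
  \<open>weyl_normal_form\<close> below), so that the standard transposition is the additive extension of
  \<open>h \<partial>^\<alpha> \<mapsto> (-1)^|\<alpha>| \<partial>^\<alpha> h\<close>.
\<close>

definition diff_op ::
    "('n expo \<Rightarrow>\<^sub>0 ('n, 'k) mpoly) \<Rightarrow> ('n::finite, 'k::field_char_0) mpoly \<Rightarrow> ('n, 'k) mpoly" where
  "diff_op h = (\<lambda>f. \<Sum>\<alpha>\<in>Poly_Mapping.keys h. Poly_Mapping.lookup h \<alpha> * partials \<alpha> f)"

definition transposition ::
    "(('n::finite, 'k::field_char_0) mpoly \<Rightarrow> ('n, 'k) mpoly) \<Rightarrow> ('n, 'k) mpoly \<Rightarrow> ('n, 'k) mpoly" where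
  "transposition a = (let h = (THE h. a = diff_op h) in
     (\<lambda>f. \<Sum>\<alpha>\<in>Poly_Mapping.keys h. (-1) ^ expo_deg \<alpha> * partials \<alpha> (Poly_Mapping.lookup h \<alpha> * f)))"


section \<open>Graded modules\<close>

text \<open>The axioms are those of \<^locale>\<open>module\<close>, without commutativity of the ring.\<close>

locale left_module = R?: ring R + M?: abelian_group M
  for R (structure) and M :: "('a, 'm, 'z) module_scheme" (structure) +
  assumes smult_closed: "\<lbrakk>a \<in> carrier R; x \<in> carrier M\<rbrakk> \<Longrightarrow> a \<odot>\<^bsub>M\<^esub> x \<in> carrier M"
    and smult_l_distr: "\<lbrakk>a \<in> carrier R; b \<in> carrier R; x \<in> carrier M\<rbrakk> \<Longrightarrow>
      (a \<oplus> b) \<odot>\<^bsub>M\<^esub> x = a \<odot>\<^bsub>M\<^esub> x \<oplus>\<^bsub>M\<^esub> b \<odot>\<^bsub>M\<^esub> x"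
    and smult_r_distr: "\<lbrakk>a \<in> carrier R; x \<in> carrier M; y \<in> carrier M\<rbrakk> \<Longrightarrow>
      a \<odot>\<^bsub>M\<^esub> (x \<oplus>\<^bsub>M\<^esub> y) = a \<odot>\<^bsub>M\<^esub> x \<oplus>\<^bsub>M\<^esub> a \<odot>\<^bsub>M\<^esub> y"
    and smult_assoc: "\<lbrakk>a \<in> carrier R; b \<in> carrier R; x \<in> carrier M\<rbrakk> \<Longrightarrow>
      (a \<otimes> b) \<odot>\<^bsub>M\<^esub> x = a \<odot>\<^bsub>M\<^esub> (b \<odot>\<^bsub>M\<^esub> x)"
    and smult_one: "x \<in> carrier M \<Longrightarrow> \<one> \<odot>\<^bsub>M\<^esub> x = x"

record ('a, 'm) graded_module = "('a, 'm) module" +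
  component :: "int \<Rightarrow> 'm set"

type_synonym ('n, 'k, 'm) weyl_module =
  "(('n, 'k) mpoly \<Rightarrow> ('n, 'k) mpoly, 'm) graded_module"

text \<open>\<open>M\<close> is the internal direct sum of the additive subgroups \<open>M_i\<close>, and \<open>(A_n)_d M_i \<subseteq> M_(d+i)\<close>.\<close>

locale graded_weyl_module = left_module weyl M
  for M :: "('n::finite, 'k::field_char_0, 'm) weyl_module" (structure) +
  assumes component_subgroup: "additive_subgroup (component M i) M"
    and direct_sum: "x \<in> carrier M \<Longrightarrow>
      \<exists>!c. (\<forall>i. c i \<in> component M i) \<and> finite {i. c i \<noteq> \<zero>\<^bsub>M\<^esub>} \<and>
           x = (\<Oplus>\<^bsub>M\<^esub>i\<in>{i. c i \<noteq> \<zero>\<^bsub>M\<^esub>}. c i)"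
    and smult_component: "\<lbrakk>a \<in> weyl_component d; x \<in> component M i\<rbrakk> \<Longrightarrow>
      a \<odot>\<^bsub>M\<^esub> x \<in> component M (d + i)"

definition strongly_generalized_eulerian ::
    "('n::finite, 'k::field_char_0, 'm) weyl_module \<Rightarrow> bool" where
  "strongly_generalized_eulerian M \<longleftrightarrow> graded_weyl_module M \<and>
     (\<exists>a::nat. a > 0 \<and> (\<forall>d. \<forall>w\<in>component M d. w \<noteq> \<zero>\<^bsub>M\<^esub> \<longrightarrow>
        ((euler \<ominus>\<^bsub>weyl\<^esub> scalar (of_int d)) [^]\<^bsub>weyl\<^esub> a) \<odot>\<^bsub>M\<^esub> w = \<zero>\<^bsub>M\<^esub>))"

definition shift :: "int \<Rightarrow> ('a, 'm) graded_module \<Rightarrow> ('a, 'm) graded_module" where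
  "shift k M = M\<lparr>component := (\<lambda>i. component M (k + i))\<rparr>"


section \<open>The graded dual\<close>

text \<open>
  Functionals on \<open>M\<close> are represented by functions on the ambient type that are \<open>0\<close> off the carrier,
  so that each functional has only one representative.
\<close>

definition K_linear :: "('n::finite, 'k::field_char_0, 'm) weyl_module \<Rightarrow> ('m \<Rightarrow> 'k) \<Rightarrow> bool" where
  "K_linear M \<phi> \<longleftrightarrow>
     (\<forall>x\<in>carrier M. \<forall>y\<in>carrier M. \<phi> (x \<oplus>\<^bsub>M\<^esub> y) = \<phi> x + \<phi> y) \<and>
     (\<forall>c. \<forall>x\<in>carrier M. \<phi> (scalar c \<odot>\<^bsub>M\<^esub> x) = c * \<phi> x) \<and>
     (\<forall>x. x \<notin> carrier M \<longrightarrow> \<phi> x = 0)"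

text \<open>\<open>Hom_K(M_(-i), K)\<close>, each functional being extended by \<open>0\<close> to the other components.\<close>

definition dual_component :: "('n::finite, 'k::field_char_0, 'm) weyl_module \<Rightarrow> int \<Rightarrow> ('m \<Rightarrow> 'k) set"
  where "dual_component M i =
    {\<phi>. K_linear M \<phi> \<and> (\<forall>j. j \<noteq> - i \<longrightarrow> (\<forall>x\<in>component M j. \<phi> x = 0))}"

text \<open>The fields \<open>mult\<close> and \<open>one\<close> of a module record carry no meaning.\<close>

definition graded_dual ::
    "('n::finite, 'k::field_char_0, 'm) weyl_module \<Rightarrow> ('n, 'k, 'm \<Rightarrow> 'k) weyl_module" where
  "graded_dual M =
     \<lparr>carrier = {(\<lambda>x. \<Sum>i\<in>I. \<phi> i x) | I \<phi>. finite I \<and> (\<forall>i\<in>I. \<phi> i \<in> dual_component M i)},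
      mult = undefined, one = undefined,
      zero = (\<lambda>x. 0), add = (\<lambda>\<phi> \<psi> x. \<phi> x + \<psi> x),
      smult = (\<lambda>a \<phi> x. if x \<in> carrier M then \<phi> (transposition a \<odot>\<^bsub>M\<^esub> x) else 0),
      component = dual_component M\<rparr>"


section \<open>Well-definedness\<close>

lemma ring_weyl: "ring (weyl :: (('n::finite, 'k::field_char_0) mpoly \<Rightarrow> ('n, 'k) mpoly) ring)"
proof -
  have zero: "(\<lambda>f. 0) \<in> (weyl_carrier :: (('n, 'k) mpoly \<Rightarrow> ('n, 'k) mpoly) set)"
    using weyl_carrier.const[of "0::'k"] by (simp add: const_def lambda_zero)
  have one: "id \<in> (weyl_carrier :: (('n, 'k) mpoly \<Rightarrow> ('n, 'k) mpoly) set)"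
  proof -
    have "id = (\<lambda>f. const 1 * f :: ('n, 'k) mpoly)" by (simp add: const_def fun_eq_iff)
    then show ?thesis by (metis weyl_carrier.const)
  qed
  have addl: "a (f + g) = a f + a g" if "a \<in> weyl_carrier" for a and f g :: "('n, 'k) mpoly"
    using that
  proof (induction arbitrary: f g)
    case (partial i)
    have *: "partial i f = (\<Sum>\<alpha>\<in>S. Poly_Mapping.single (\<alpha> - Poly_Mapping.single i 1) (of_nat (Poly_Mapping.lookup \<alpha> i) * Poly_Mapping.lookup f \<alpha>))"
      if "finite S" "Poly_Mapping.keys f \<subseteq> S" for S and f :: "('n, 'k) mpoly"
      unfolding partial_def using that
      by (intro sum.mono_neutral_left) (auto simp: in_keys_iff)
    let ?S = "Poly_Mapping.keys f \<union> Poly_Mapping.keys g"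
    have "Poly_Mapping.keys (f + g) \<subseteq> ?S" by (rule Poly_Mapping.keys_add)
    then show ?case
      by (simp add: *[of ?S] lookup_add distrib_left single_add sum.distrib)
  qed (auto simp: distrib_left algebra_simps)
  have uminus: "(\<lambda>f. - a f) \<in> weyl_carrier" if "a \<in> weyl_carrier" for a :: "('n, 'k) mpoly \<Rightarrow> ('n, 'k) mpoly"
  proof -
    have "const (-1) = (-1 :: ('n, 'k) mpoly)"
      by (simp add: const_def single_uminus)
    then show ?thesis
      using weyl_carrier.comp[OF weyl_carrier.const[of "-1"] that] by (simp add: comp_def)
  qed
  show ?thesis
  proof (rule ringI)
    show "abelian_group (weyl :: (('n, 'k) mpoly \<Rightarrow> ('n, 'k) mpoly) ring)"
    proof (rule abelian_groupI)
      fix x :: "('n, 'k) mpoly \<Rightarrow> ('n, 'k) mpoly"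
      assume "x \<in> carrier weyl"
      then show "\<exists>y\<in>carrier weyl. y \<oplus>\<^bsub>weyl\<^esub> x = \<zero>\<^bsub>weyl\<^esub>"
        by (intro bexI[of _ "\<lambda>f. - x f"]) (auto simp: weyl_def intro: uminus)
    qed (simp_all add: weyl_def zero weyl_carrier.add add.commute add.left_commute add.assoc)
    show "Group.monoid (weyl :: (('n, 'k) mpoly \<Rightarrow> ('n, 'k) mpoly) ring)"
      by (rule monoidI) (auto simp: weyl_def one comp_assoc intro: weyl_carrier.comp)
    fix x y z :: "('n, 'k) mpoly \<Rightarrow> ('n, 'k) mpoly"
    assume xyz: "x \<in> carrier weyl" "y \<in> carrier weyl" "z \<in> carrier weyl"
    show "(x \<oplus>\<^bsub>weyl\<^esub> y) \<otimes>\<^bsub>weyl\<^esub> z = x \<otimes>\<^bsub>weyl\<^esub> z \<oplus>\<^bsub>weyl\<^esub> y \<otimes>\<^bsub>weyl\<^esub> z"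
      by (simp add: weyl_def comp_def)
    show "z \<otimes>\<^bsub>weyl\<^esub> (x \<oplus>\<^bsub>weyl\<^esub> y) = z \<otimes>\<^bsub>weyl\<^esub> x \<oplus>\<^bsub>weyl\<^esub> z \<otimes>\<^bsub>weyl\<^esub> y"
      using xyz by (simp add: weyl_def comp_def addl)
  qed
qed

lemma partial_superset:
  fixes f :: "('n::finite, 'k::field_char_0) mpoly"
  assumes "finite S" "Poly_Mapping.keys f \<subseteq> S"
  shows "partial i f = (\<Sum>\<alpha>\<in>S. Poly_Mapping.single (\<alpha> - Poly_Mapping.single i 1) (of_nat (Poly_Mapping.lookup \<alpha> i) * Poly_Mapping.lookup f \<alpha>))"
  unfolding partial_def using assms
  by (intro sum.mono_neutral_left) (auto simp: in_keys_iff)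

lemma partial_add: "partial i (f + g) = partial i f + partial i g"
proof -
  let ?S = "Poly_Mapping.keys f \<union> Poly_Mapping.keys g"
  have "Poly_Mapping.keys (f + g) \<subseteq> ?S" by (rule Poly_Mapping.keys_add)
  then show ?thesis
    by (simp add: partial_superset[of ?S] lookup_add distrib_left single_add sum.distrib)
qed

lemma partial_0 [simp]: "partial i 0 = 0"
  by (simp add: partial_def)

lemma partial_single: "partial i (Poly_Mapping.single \<alpha> c) =
  Poly_Mapping.single (\<alpha> - Poly_Mapping.single i 1) (of_nat (Poly_Mapping.lookup \<alpha> i) * c)"
  by (cases "c = 0") (simp_all add: partial_def)

lemma mpoly_induct [case_names single add]:
  assumes "\<And>\<alpha> c. P (Poly_Mapping.single \<alpha> c)"
    and "\<And>f g. P f \<Longrightarrow> P g \<Longrightarrow> P (f + g)"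
  shows "P (f :: ('n, 'k::field_char_0) mpoly)"
proof -
  have "P (\<Sum>\<alpha>\<in>S. Poly_Mapping.single \<alpha> (Poly_Mapping.lookup f \<alpha>))" if "finite S" for S
    using that
  proof induction
    case empty
    show ?case using assms(1)[of 0 0] by simp
  qed (use assms in auto)
  moreover have "(\<Sum>\<alpha>\<in>Poly_Mapping.keys f. Poly_Mapping.single \<alpha> (Poly_Mapping.lookup f \<alpha>)) = f"
    by (rule poly_mapping_eqI) (auto simp: lookup_sum lookup_single when_def in_keys_iff)
  ultimately show ?thesis by (metis finite_keys)
qed

lemma partial_commute: "partial i (partial j f) = partial j (partial i f)"
proof (induction f rule: mpoly_induct)
  case (single \<alpha> c)
  show ?case
    by (cases "i = j")
      (auto simp: partial_single lookup_minus lookup_single diff_diff_add ac_simps intro!: arg_cong2[where f = Poly_Mapping.single] poly_mapping_eqI)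
qed (simp add: partial_add)

lemma partial_times: "partial i (f * g) = partial i f * g + f * partial i g"
proof (induction f rule: mpoly_induct)
  case f: (single \<alpha> c)
  show ?case
  proof (induction g rule: mpoly_induct)
    case (single \<beta> d)
    have 1: "(\<alpha> + \<beta> - Poly_Mapping.single i 1) = (\<alpha> - Poly_Mapping.single i 1) + \<beta>"
      if "Poly_Mapping.lookup \<alpha> i \<noteq> 0" using that
      by (intro poly_mapping_eqI) (auto simp: lookup_add lookup_minus lookup_single when_def)
    have 2: "(\<alpha> + \<beta> - Poly_Mapping.single i 1) = \<alpha> + (\<beta> - Poly_Mapping.single i 1)"
      if "Poly_Mapping.lookup \<beta> i \<noteq> 0" using that
      by (intro poly_mapping_eqI) (auto simp: lookup_add lookup_minus lookup_single when_def)
    show ?case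
      using 1 2
      by (cases "Poly_Mapping.lookup \<alpha> i = 0"; cases "Poly_Mapping.lookup \<beta> i = 0")
         (simp_all add: partial_single mult_single lookup_add single_add[symmetric] distrib_right distrib_left mult.left_commute mult.assoc)
  qed (simp add: partial_add algebra_simps)
qed (simp add: partial_add algebra_simps)

lemma partial_pow_commute: fixes f :: "('a::finite, 'b::field_char_0) mpoly" shows "(partial i ^^ a) ((partial j ^^ b) f) = (partial j ^^ b) ((partial i ^^ a) f)"
proof -
  have 1: "partial i ((partial j ^^ b) f) = (partial j ^^ b) (partial i f)" for f :: "('a, 'b) mpoly" and b
    proof (induction b)
      case (Suc b)
      then show ?case using partial_commute[of i j "(partial j ^^ b) f"] by simp
    qed simp
  show ?thesis by (induction a) (auto simp: 1)
qed

definition partials_on where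
  "partials_on S \<alpha> = Finite_Set.fold (\<lambda>i g. (partial i ^^ Poly_Mapping.lookup \<alpha> i) \<circ> g) id S"

interpretation pc: comp_fun_commute "\<lambda>i g. (partial i ^^ Poly_Mapping.lookup \<alpha> i) \<circ> g"
  by standard (auto simp: fun_eq_iff partial_pow_commute)

lemma partials_on_insert: "finite S \<Longrightarrow> i \<notin> S \<Longrightarrow>
  partials_on (insert i S) \<alpha> f = (partial i ^^ Poly_Mapping.lookup \<alpha> i) (partials_on S \<alpha> f)"
  by (simp add: partials_on_def)

lemma partials_on_empty [simp]: "partials_on {} \<alpha> f = f"
  by (simp add: partials_on_def)

lemma partials_eq: "partials \<alpha> = partials_on UNIV \<alpha>"
  by (simp add: partials_on_def partials_def)

lemma partials_on_Suc: "finite S \<Longrightarrow>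
  partials_on S (\<alpha> + Poly_Mapping.single i 1) f = (if i \<in> S then partial i (partials_on S \<alpha> f) else partials_on S \<alpha> f)"
proof (induction S rule: finite_induct)
  case (insert j S)
  then show ?case
    using partial_pow_commute[where i=i and a=1, symmetric]
    by (auto simp: partials_on_insert lookup_add lookup_single when_def)
qed auto

lemma partials_Suc: "partials (\<alpha> + Poly_Mapping.single i 1) f = partial i (partials \<alpha> f)"
  unfolding partials_eq by (subst partials_on_Suc) auto

lemma partials_0 [simp]: "partials 0 f = f"
proof -
  have "partials_on S 0 f = f" if "finite S" for S
    using that by induction (auto simp: partials_on_insert)
  then show ?thesis by (simp add: partials_eq)
qed

lemma partial_pow_single: "\<exists>k. \<forall>c. (partial i ^^ m) (Poly_Mapping.single \<alpha> c) =
   Poly_Mapping.single (\<alpha> - Poly_Mapping.single i m) (k * c :: 'k::field_char_0) \<and> (k = 0 \<longleftrightarrow> Poly_Mapping.lookup \<alpha> i < m)"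
proof (induction m)
  case (Suc m)
  then obtain k where k: "\<And>c::'k. (partial i ^^ m) (Poly_Mapping.single \<alpha> c) =
   Poly_Mapping.single (\<alpha> - Poly_Mapping.single i m) (k * c)" "(k = 0 \<longleftrightarrow> Poly_Mapping.lookup \<alpha> i < m)" by blast
  have *: "\<alpha> - Poly_Mapping.single i m - Poly_Mapping.single i 1 = \<alpha> - Poly_Mapping.single i (Suc m)"
    by (auto intro!: poly_mapping_eqI simp: lookup_minus lookup_single when_def)
  show ?case
  proof (intro exI[of _ "of_nat (Poly_Mapping.lookup (\<alpha> - Poly_Mapping.single i m) i) * k"] allI conjI)
    fix c :: 'k
    show "(partial i ^^ Suc m) (Poly_Mapping.single \<alpha> c) = Poly_Mapping.single (\<alpha> - Poly_Mapping.single i (Suc m)) (of_nat (Poly_Mapping.lookup (\<alpha> - Poly_Mapping.single i m) i) * k * c)"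
      by (simp add: k(1) partial_single *[simplified] mult.assoc)
  qed (auto simp: k(2) lookup_minus)
qed (auto intro!: exI[of _ 1])

lemma partials_on_single:
  assumes "finite S"
  shows "\<exists>k \<gamma>. (\<forall>c. partials_on S \<beta> (Poly_Mapping.single \<alpha> c) = Poly_Mapping.single \<gamma> (k * c :: 'k::field_char_0))
    \<and> (\<forall>i. Poly_Mapping.lookup \<gamma> i = Poly_Mapping.lookup \<alpha> i - (if i \<in> S then Poly_Mapping.lookup \<beta> i else 0))
    \<and> (k = 0 \<longleftrightarrow> (\<exists>i\<in>S. Poly_Mapping.lookup \<alpha> i < Poly_Mapping.lookup \<beta> i))"
  using assms
proof (induction rule: finite_induct)
  case empty
  then show ?case by (intro exI[of _ 1] exI[of _ \<alpha>]) auto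
next
  case (insert j S)
  from insert.IH obtain k \<gamma> where k: "\<And>c::'k. partials_on S \<beta> (Poly_Mapping.single \<alpha> c) = Poly_Mapping.single \<gamma> (k * c)"
    "\<And>i. Poly_Mapping.lookup \<gamma> i = Poly_Mapping.lookup \<alpha> i - (if i \<in> S then Poly_Mapping.lookup \<beta> i else 0)"
    "k = 0 \<longleftrightarrow> (\<exists>i\<in>S. Poly_Mapping.lookup \<alpha> i < Poly_Mapping.lookup \<beta> i)" by blast
  have "\<exists>l. \<forall>c. (partial j ^^ Poly_Mapping.lookup \<beta> j) (Poly_Mapping.single \<gamma> c) =
      Poly_Mapping.single (\<gamma> - Poly_Mapping.single j (Poly_Mapping.lookup \<beta> j)) (l * c :: 'k) \<and> (l = 0 \<longleftrightarrow> Poly_Mapping.lookup \<gamma> j < Poly_Mapping.lookup \<beta> j)"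
    by (rule partial_pow_single)
  then obtain l where
    l: "\<And>c::'k. (partial j ^^ Poly_Mapping.lookup \<beta> j) (Poly_Mapping.single \<gamma> c) =
      Poly_Mapping.single (\<gamma> - Poly_Mapping.single j (Poly_Mapping.lookup \<beta> j)) (l * c)"
      "l = 0 \<longleftrightarrow> Poly_Mapping.lookup \<gamma> j < Poly_Mapping.lookup \<beta> j" by blast
  show ?case
    using insert.hyps
    by (intro exI[of _ "l * k"] exI[of _ "\<gamma> - Poly_Mapping.single j (Poly_Mapping.lookup \<beta> j)"])
      (auto simp: partials_on_insert k l lookup_minus lookup_single when_def mult.assoc)
qed

lemma expo_deg_less_ex: "expo_deg \<alpha> \<le> expo_deg \<beta> \<Longrightarrow> \<alpha> \<noteq> \<beta> \<Longrightarrow> \<exists>i. Poly_Mapping.lookup \<alpha> i < Poly_Mapping.lookup \<beta> i"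
proof (rule ccontr)
  assume a: "expo_deg \<alpha> \<le> expo_deg \<beta>" "\<alpha> \<noteq> \<beta>" "\<nexists>i. Poly_Mapping.lookup \<alpha> i < Poly_Mapping.lookup \<beta> i"
  then have le: "Poly_Mapping.lookup \<beta> i \<le> Poly_Mapping.lookup \<alpha> i" for i by (meson not_le)
  from a(2) obtain i where "Poly_Mapping.lookup \<alpha> i \<noteq> Poly_Mapping.lookup \<beta> i" by (metis poly_mapping_eqI)
  with le have "Poly_Mapping.lookup \<beta> i < Poly_Mapping.lookup \<alpha> i" by (metis le_neq_implies_less)
  then have "expo_deg \<beta> < expo_deg \<alpha>" unfolding expo_deg_def
    by (intro sum_strict_mono_ex1) (use le in auto)
  with a(1) show False by simp
qed

lemma diff_op_superset:
  assumes "finite S" "Poly_Mapping.keys h \<subseteq> S"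
  shows "diff_op h f = (\<Sum>\<alpha>\<in>S. Poly_Mapping.lookup h \<alpha> * partials \<alpha> f)"
  unfolding diff_op_def using assms
  by (intro sum.mono_neutral_left) (auto simp: in_keys_iff)

lemma diff_op_add: "diff_op (g + h) f = diff_op g f + diff_op h f"
proof -
  let ?S = "Poly_Mapping.keys g \<union> Poly_Mapping.keys h"
  have "Poly_Mapping.keys (g + h) \<subseteq> ?S" by (rule Poly_Mapping.keys_add)
  then show ?thesis
    by (simp add: diff_op_superset[of ?S] lookup_add distrib_right sum.distrib)
qed

lemma diff_op_zero: "diff_op 0 f = 0" by (simp add: diff_op_def)

lemma diff_op_single: "diff_op (Poly_Mapping.single \<alpha> g) f = g * partials \<alpha> f"
  by (cases "g = 0") (auto simp: diff_op_def)

lemma diff_op_inj_0: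
  fixes h :: "'n::finite expo \<Rightarrow>\<^sub>0 ('n, 'k::field_char_0) mpoly"
  assumes "\<And>f. diff_op h f = 0"
  shows "h = 0"
proof (rule ccontr)
  assume "h \<noteq> 0"
  then have "Poly_Mapping.keys h \<noteq> {}" by simp
  then obtain \<alpha> where \<alpha>: "\<alpha> \<in> Poly_Mapping.keys h" "\<And>\<beta>. \<beta> \<in> Poly_Mapping.keys h \<Longrightarrow> expo_deg \<alpha> \<le> expo_deg \<beta>"
    using ex_has_least_nat[of "\<lambda>\<beta>. \<beta> \<in> Poly_Mapping.keys h" _ expo_deg] by blast
  let ?f = "Poly_Mapping.single \<alpha> 1 :: ('n, 'k) mpoly"
  have z: "partials \<beta> ?f = 0" if "\<beta> \<in> Poly_Mapping.keys h" "\<beta> \<noteq> \<alpha>" for \<beta>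
  proof -
    from expo_deg_less_ex[OF \<alpha>(2)[OF that(1)]] that(2) obtain i where "Poly_Mapping.lookup \<alpha> i < Poly_Mapping.lookup \<beta> i" by blast
    moreover obtain k \<gamma> where "\<And>c::'k. partials_on UNIV \<beta> (Poly_Mapping.single \<alpha> c) = Poly_Mapping.single \<gamma> (k * c)"
      "k = 0 \<longleftrightarrow> (\<exists>i. Poly_Mapping.lookup \<alpha> i < Poly_Mapping.lookup \<beta> i)"
      using partials_on_single[OF finite_class.finite_UNIV, of \<beta> \<alpha>] by blast
    ultimately have "k = 0" "partials \<beta> ?f = Poly_Mapping.single \<gamma> (k * 1)" unfolding partials_eq by blast+
    then show ?thesis by simp
  qed
  obtain k :: 'k and \<gamma> where k: "partials \<alpha> ?f = Poly_Mapping.single \<gamma> k" "k \<noteq> 0" "\<And>i. Poly_Mapping.lookup \<gamma> i = 0"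
  proof -
    obtain k \<gamma> where k: "\<And>c::'k. partials_on UNIV \<alpha> (Poly_Mapping.single \<alpha> c) = Poly_Mapping.single \<gamma> (k * c)"
      "\<And>i. Poly_Mapping.lookup \<gamma> i = Poly_Mapping.lookup \<alpha> i - (if i \<in> UNIV then Poly_Mapping.lookup \<alpha> i else 0)"
      "k = 0 \<longleftrightarrow> (\<exists>i. Poly_Mapping.lookup \<alpha> i < Poly_Mapping.lookup \<alpha> i)"
      using partials_on_single[OF finite_class.finite_UNIV, of \<alpha> \<alpha>] by blast
    show ?thesis
    proof (rule that)
      show "partials \<alpha> ?f = Poly_Mapping.single \<gamma> k" using k(1)[of 1] by (simp add: partials_eq)
      show "k \<noteq> 0" using k(3) by blast
      show "Poly_Mapping.lookup \<gamma> i = 0" for i using k(2)[of i] by simp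
    qed
  qed
  have "\<gamma> = 0" using k(3) by (intro poly_mapping_eqI) auto
  have "diff_op h ?f = Poly_Mapping.lookup h \<alpha> * partials \<alpha> ?f"
    unfolding diff_op_def
    by (subst sum.remove[OF _ \<alpha>(1)]) (simp_all add: z sum.neutral)
  also have "\<dots> = Poly_Mapping.lookup h \<alpha> * const k" by (simp add: k \<open>\<gamma> = 0\<close> const_def)
  finally have "Poly_Mapping.lookup h \<alpha> * const k = 0" using assms by simp
  then have "Poly_Mapping.lookup h \<alpha> * (const k * const (1/k)) = 0" unfolding mult.assoc[symmetric] by simp
  moreover have "const k * const (1/k) = (1 :: ('n, 'k) mpoly)" using k(2) by (simp add: const_def mult_single)
  ultimately show False using \<alpha>(1) by (simp add: in_keys_iff)
qed

lemma diff_op_inj: "diff_op g = diff_op h \<Longrightarrow> g = h"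
proof -
  assume a: "diff_op g = diff_op h"
  have "diff_op (g - h) f = 0" for f
    using diff_op_add[of "g - h" h f] a by simp
  from diff_op_inj_0[OF this] show ?thesis by simp
qed

lemma diff_op_sum_single:
  "\<exists>h'. \<forall>f. diff_op h' f = (\<Sum>\<alpha>\<in>S. g \<alpha> * partials (e \<alpha>) f)" if "finite S"
  using that
proof (induction)
  case empty
  show ?case by (rule exI[of _ 0]) (auto simp: diff_op_zero)
next
  case (insert x S)
  then obtain h' where h': "\<And>f. diff_op h' f = (\<Sum>\<alpha>\<in>S. g \<alpha> * partials (e \<alpha>) f)" by blast
  show ?case using insert.hyps
    by (intro exI[of _ "Poly_Mapping.single (e x) (g x) + h'"]) (auto simp: diff_op_add diff_op_single h')
qed

lemma partial_sum: "partial i (\<Sum>x\<in>S. g x) = (\<Sum>x\<in>S. partial i (g x))"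
  by (induction S rule: infinite_finite_induct) (auto simp: partial_add)

lemma weyl_comp_normal:
  assumes "a \<in> weyl_carrier" shows "\<exists>h'. \<forall>f. diff_op h' f = a (diff_op h f)"
  using assms
proof (induction arbitrary: h)
  case (const c)
  show ?case using diff_op_sum_single[of "Poly_Mapping.keys h" "\<lambda>\<alpha>. const c * Poly_Mapping.lookup h \<alpha>" "\<lambda>\<alpha>. \<alpha>"]
    by (simp add: diff_op_def sum_distrib_left mult.assoc)
next
  case (var i)
  show ?case using diff_op_sum_single[of "Poly_Mapping.keys h" "\<lambda>\<alpha>. var i * Poly_Mapping.lookup h \<alpha>" "\<lambda>\<alpha>. \<alpha>"]
    by (simp add: diff_op_def sum_distrib_left mult.assoc)
next
  case (partial i)
  obtain h1 where h1: "\<And>f. diff_op h1 f = (\<Sum>\<alpha>\<in>Poly_Mapping.keys h. partial i (Poly_Mapping.lookup h \<alpha>) * partials \<alpha> f)"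
    using diff_op_sum_single[of "Poly_Mapping.keys h" "\<lambda>\<alpha>. partial i (Poly_Mapping.lookup h \<alpha>)" "\<lambda>\<alpha>. \<alpha>"] by auto
  obtain h2 where h2: "\<And>f. diff_op h2 f = (\<Sum>\<alpha>\<in>Poly_Mapping.keys h. Poly_Mapping.lookup h \<alpha> * partials (\<alpha> + Poly_Mapping.single i 1) f)"
    using diff_op_sum_single[of "Poly_Mapping.keys h" "\<lambda>\<alpha>. Poly_Mapping.lookup h \<alpha>" "\<lambda>\<alpha>. \<alpha> + Poly_Mapping.single i 1"] by auto
  show ?case
    by (intro exI[of _ "h1 + h2"]) (simp only: diff_op_add h1 h2 partials_Suc diff_op_def[of h] partial_sum partial_times sum.distrib simp_thms)
next
  case (add a b)
  then obtain h1 h2 where "\<And>f. diff_op h1 f = a (diff_op h f)" "\<And>f. diff_op h2 f = b (diff_op h f)" by metis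
  then show ?case by (intro exI[of _ "h1 + h2"]) (simp add: diff_op_add)
next
  case (comp a b)
  then show ?case by (metis comp_apply)
qed

lemma weyl_normal_form: "a \<in> weyl_carrier \<Longrightarrow> \<exists>!h. a = diff_op h"
proof -
  assume "a \<in> weyl_carrier"
  from weyl_comp_normal[OF this, of "Poly_Mapping.single 0 1"] obtain h where "\<And>f. diff_op h f = a f"
    by (auto simp: diff_op_single simp del: single_one)
  then have "a = diff_op h" by auto
  then show ?thesis using diff_op_inj by blast
qed

lemma transposition_diff_op:
  "transposition (diff_op h) = (\<lambda>f. \<Sum>\<alpha>\<in>Poly_Mapping.keys h. (-1) ^ expo_deg \<alpha> * partials \<alpha> (Poly_Mapping.lookup h \<alpha> * f))"
proof -
  have "(THE g. diff_op h = diff_op g) = h" using diff_op_inj by blast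
  then show ?thesis by (simp add: transposition_def)
qed

lemma transposition_times: "transposition (\<lambda>f. g * f) = (\<lambda>f. g * f)"
proof -
  have e: "diff_op (Poly_Mapping.single 0 g) = (\<lambda>f. g * f)" by (auto simp: diff_op_single)
  show ?thesis
    by (subst e[symmetric], subst transposition_diff_op) (cases "g = 0"; simp add: expo_deg_def fun_eq_iff)
qed

lemma transposition_partial: "transposition (partial i) = (\<lambda>f. - partial i f)"
proof -
  have p: "partials (Poly_Mapping.single i 1) f = partial i f" for f
    using partials_Suc[of 0 i f] by simp
  have e: "diff_op (Poly_Mapping.single (Poly_Mapping.single i 1) 1) = partial i" by (auto simp: diff_op_single p[simplified])
  have d: "expo_deg (Poly_Mapping.single i 1) = 1" by (simp add: expo_deg_def lookup_single when_def)
  show ?thesis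
    by (subst e[symmetric], subst transposition_diff_op) (simp add: d[simplified] p[simplified])
qed

end

theory Submission
  imports Defs
begin

text \<open>
  Write \<open>N = M(-n)\<close>, \<open>E\<close> for the Euler operator and \<open>\<tau>\<close> for the transposition.  Since
  \<open>\<tau>(X_i \<partial>_i) = - \<partial>_i X_i = - X_i \<partial>_i - 1\<close>, we have \<open>\<tau>(E) = - E - n\<close> and hence
  \<open>\<tau>(E - d) = - (E - (- n - d))\<close>.  A functional \<open>\<phi>\<close> of degree \<open>d\<close> in the dual of \<open>N\<close> lives on
  \<open>N_(-d) = M_(-n-d)\<close>, and for \<open>x\<close> in this component
  \<open>((E - d)^a \<phi>)(x) = \<phi>(\<tau>((E - d)^a) x) = (-1)^a \<phi>((E - (-n-d))^a x) = 0\<close>,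
  where \<open>a\<close> is the exponent that works for \<open>M\<close>.  So the same exponent works for the dual.

  Most of the work is to show that the dual is a graded module at all.  This comes from three
  properties of \<open>\<tau>\<close>: it is additive (\<open>transposition_add\<close>), it reverses products
  (\<open>transposition_comp\<close>), and it preserves degrees (\<open>transposition_in_component\<close>).  The first two make
  the action of the Weyl algebra on functionals a left module structure, the third makes it graded
  (\<open>graded_weyl_module_dual\<close>).
\<close>

section \<open>Generation of the Weyl algebra by monomials\<close>

lemma expo_induct [case_names zero Suc]:
  fixes \<alpha> :: "'n::finite expo"
  assumes "P 0" and "\<And>\<alpha> i. P \<alpha> \<Longrightarrow> P (\<alpha> + Poly_Mapping.single i 1)"
  shows "P \<alpha>"
proof (induction "expo_deg \<alpha>" arbitrary: \<alpha> rule: less_induct)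
  case less
  show ?case
  proof (cases "\<alpha> = 0")
    case False
    then obtain i where i: "Poly_Mapping.lookup \<alpha> i \<noteq> 0"
      by (metis lookup_zero poly_mapping_eqI)
    let ?\<beta> = "\<alpha> - Poly_Mapping.single i 1"
    have eq: "\<alpha> = ?\<beta> + Poly_Mapping.single i 1"
      using i by (intro poly_mapping_eqI) (auto simp: lookup_add lookup_minus lookup_single when_def)
    have "expo_deg ?\<beta> < expo_deg \<alpha>"
      unfolding expo_deg_def using i
      by (intro sum_strict_mono_ex1) (auto simp: lookup_minus lookup_single when_def)
    then show ?thesis using assms(2)[OF less, of ?\<beta> i] by (simp only: eq[symmetric])
  qed (simp add: assms(1))
qed

lemma expo_deg_0 [simp]: "expo_deg 0 = 0"
  by (simp add: expo_deg_def)

lemma expo_deg_Suc [simp]: "expo_deg (\<alpha> + Poly_Mapping.single i 1) = Suc (expo_deg \<alpha>)"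
  by (simp add: expo_deg_def lookup_add sum.distrib lookup_single when_def)

definition monomial_op :: "'n expo \<Rightarrow> 'n expo \<Rightarrow> 'k \<Rightarrow>
    ('n::finite, 'k::field_char_0) mpoly \<Rightarrow> ('n, 'k) mpoly" where
  "monomial_op \<alpha> \<beta> c = (\<lambda>f. Poly_Mapping.single \<alpha> c * partials \<beta> f)"

lemma zero_in_weyl_carrier: "(\<lambda>f. 0) \<in> weyl_carrier"
  using weyl_carrier.const[of 0] by (simp add: const_def lambda_zero)

lemma id_in_weyl_carrier: "id \<in> (weyl_carrier :: (('n::finite, 'k::field_char_0) mpoly \<Rightarrow> _) set)"
proof -
  have "id = (\<lambda>f. const 1 * f :: ('n, 'k) mpoly)" by (simp add: const_def fun_eq_iff)
  then show ?thesis by (metis weyl_carrier.const)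
qed

lemma partials_in_weyl_carrier:
  "partials \<beta> \<in> (weyl_carrier :: (('n::finite, 'k::field_char_0) mpoly \<Rightarrow> _) set)"
proof (induction \<beta> rule: expo_induct)
  case zero
  have "partials 0 = id" by auto
  then show ?case by (metis id_in_weyl_carrier)
next
  case (Suc \<beta> i)
  have "partials (\<beta> + Poly_Mapping.single i 1) = (partial i \<circ> partials \<beta> :: ('n, 'k) mpoly \<Rightarrow> _)"
    by (auto simp: partials_Suc[simplified])
  then show ?case using weyl_carrier.comp[OF weyl_carrier.partial[of i] Suc] by (simp only:)
qed

lemma times_in_weyl_carrier: "(\<lambda>f. g * f) \<in> weyl_carrier"
proof (induction g rule: mpoly_induct)
  case (single \<alpha> c)
  show ?case
  proof (induction \<alpha> rule: expo_induct)
    case zero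
    show ?case using weyl_carrier.const[of c] by (simp add: const_def)
  next
    case (Suc \<alpha> i)
    have "var i * Poly_Mapping.single \<alpha> c = Poly_Mapping.single (\<alpha> + Poly_Mapping.single i 1) c"
      by (simp add: var_def mult_single add.commute)
    then show ?case
      using weyl_carrier.comp[OF weyl_carrier.var[of i] Suc] by (simp add: comp_def flip: mult.assoc)
  qed
next
  case (add f g)
  then show ?case using weyl_carrier.add by (simp add: distrib_right)
qed

lemma monomial_op_in_weyl_carrier: "monomial_op \<alpha> \<beta> c \<in> weyl_carrier"
  using weyl_carrier.comp[OF times_in_weyl_carrier partials_in_weyl_carrier]
  by (simp add: monomial_op_def comp_def)

text \<open>
  Additive statements about the Weyl algebra need checking only on the monomials
  \<open>c X^\<alpha> \<partial>^\<beta>\<close>, by the normal form.  Monomials are homogeneous, so this also reduces claims about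
  arbitrary operators to claims about homogeneous ones.
\<close>

lemma weyl_carrier_induct [consumes 1, case_names monomial add]:
  fixes a :: "('n::finite, 'k::field_char_0) mpoly \<Rightarrow> ('n, 'k) mpoly"
  assumes "a \<in> weyl_carrier"
    and mono: "\<And>\<alpha> \<beta> c. P (monomial_op \<alpha> \<beta> c)"
    and add: "\<And>a b. a \<in> weyl_carrier \<Longrightarrow> b \<in> weyl_carrier \<Longrightarrow> P a \<Longrightarrow> P b \<Longrightarrow> P (\<lambda>f. a f + b f)"
  shows "P a"
proof -
  let ?Q = "\<lambda>a. a \<in> weyl_carrier \<and> P a"
  have Q_add: "?Q (\<lambda>f. a f + b f)" if "?Q a" "?Q b" for a b
    using that add weyl_carrier.add by blast
  have 1: "?Q (\<lambda>f. g * partials \<beta> f)" for g \<beta>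
  proof (induction g rule: mpoly_induct)
    case (single \<alpha> c)
    show ?case using mono[of \<alpha> \<beta> c] monomial_op_in_weyl_carrier[of \<alpha> \<beta> c] by (simp add: monomial_op_def)
  next
    case (add f g)
    from Q_add[OF this] show ?case by (simp only: distrib_right)
  qed
  have 0: "?Q (\<lambda>f. 0)" using 1[of 0] by simp
  have "?Q (\<lambda>f. \<Sum>\<alpha>\<in>S. g \<alpha> * partials \<alpha> f)" if "finite S" for S and g :: "_ \<Rightarrow> ('n, 'k) mpoly"
    using that
  proof induction
    case (insert x S)
    from Q_add[OF 1 this(3)] show ?case using insert.hyps by simp
  qed (simp add: 0)
  from this[OF finite_keys] show ?thesis
    using weyl_normal_form[OF assms(1)] unfolding diff_op_def by blast
qed

lemma monomial_op_in_component:
  assumes "d = int (expo_deg \<alpha>) - int (expo_deg \<beta>)"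
  shows "monomial_op \<alpha> \<beta> c \<in> weyl_component d"
  unfolding weyl_component_def
  using assms by (auto intro!: exI[of _ "{(\<alpha>, \<beta>)}"] exI[of _ "\<lambda>_ _. c"] simp: monomial_op_def)

lemma zero_in_component: "(\<lambda>f. 0) \<in> weyl_component d"
  unfolding weyl_component_def by (auto intro!: exI[of _ "{}"])

text \<open>
  Two homogeneous operators may be given by coefficient families on different sets of exponent
  pairs; extending both families by zero to the union makes them comparable.
\<close>

lemma add_in_component:
  assumes "a \<in> weyl_component d" "b \<in> weyl_component d"
  shows "(\<lambda>f. a f + b f) \<in> weyl_component d"
proof -
  from assms(1) obtain S c where S: "finite S" "\<forall>(\<alpha>, \<beta>)\<in>S. int (expo_deg \<alpha>) - int (expo_deg \<beta>) = d"
    "a = (\<lambda>f. \<Sum>(\<alpha>, \<beta>)\<in>S. Poly_Mapping.single \<alpha> (c \<alpha> \<beta>) * partials \<beta> f)"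
    unfolding weyl_component_def by blast
  from assms(2) obtain T e where T: "finite T" "\<forall>(\<alpha>, \<beta>)\<in>T. int (expo_deg \<alpha>) - int (expo_deg \<beta>) = d"
    "b = (\<lambda>f. \<Sum>(\<alpha>, \<beta>)\<in>T. Poly_Mapping.single \<alpha> (e \<alpha> \<beta>) * partials \<beta> f)"
    unfolding weyl_component_def by blast
  let ?c = "\<lambda>\<alpha> \<beta>. if (\<alpha>, \<beta>) \<in> S then c \<alpha> \<beta> else 0"
  let ?e = "\<lambda>\<alpha> \<beta>. if (\<alpha>, \<beta>) \<in> T then e \<alpha> \<beta> else 0"
  have a: "a f = (\<Sum>(\<alpha>, \<beta>)\<in>S \<union> T. Poly_Mapping.single \<alpha> (?c \<alpha> \<beta>) * partials \<beta> f)" for f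
    unfolding S(3) using S(1) T(1) by (intro sum.mono_neutral_cong_left) auto
  have b: "b f = (\<Sum>(\<alpha>, \<beta>)\<in>S \<union> T. Poly_Mapping.single \<alpha> (?e \<alpha> \<beta>) * partials \<beta> f)" for f
    unfolding T(3) using S(1) T(1) by (intro sum.mono_neutral_cong_left) auto
  have "(\<lambda>f. a f + b f) =
      (\<lambda>f. \<Sum>(\<alpha>, \<beta>)\<in>S \<union> T. Poly_Mapping.single \<alpha> (?c \<alpha> \<beta> + ?e \<alpha> \<beta>) * partials \<beta> f)"
    unfolding a b by (simp only: sum.distrib[symmetric] case_prod_unfold single_add distrib_right)
  moreover have "\<forall>(\<alpha>, \<beta>)\<in>S \<union> T. int (expo_deg \<alpha>) - int (expo_deg \<beta>) = d"
    using S(2) T(2) by auto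
  moreover have "finite (S \<union> T)" using S(1) T(1) by simp
  ultimately show ?thesis
    unfolding weyl_component_def
    by (intro CollectI exI[of _ "S \<union> T"] exI[of _ "\<lambda>\<alpha> \<beta>. ?c \<alpha> \<beta> + ?e \<alpha> \<beta>"] conjI)
qed

lemma weyl_component_induct [consumes 1, case_names zero monomial add]:
  assumes "a \<in> weyl_component d"
    and zero: "P (\<lambda>f. 0)"
    and mono: "\<And>\<alpha> \<beta> c. d = int (expo_deg \<alpha>) - int (expo_deg \<beta>) \<Longrightarrow> P (monomial_op \<alpha> \<beta> c)"
    and add: "\<And>a b. a \<in> weyl_component d \<Longrightarrow> b \<in> weyl_component d \<Longrightarrow> P a \<Longrightarrow> P b \<Longrightarrow> P (\<lambda>f. a f + b f)"
  shows "P a"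
proof -
  from assms(1) obtain S c where S: "finite S" "\<forall>(\<alpha>, \<beta>)\<in>S. int (expo_deg \<alpha>) - int (expo_deg \<beta>) = d"
    "a = (\<lambda>f. \<Sum>(\<alpha>, \<beta>)\<in>S. Poly_Mapping.single \<alpha> (c \<alpha> \<beta>) * partials \<beta> f)"
    unfolding weyl_component_def by blast
  let ?Q = "\<lambda>a. a \<in> weyl_component d \<and> P a"
  have "?Q (\<lambda>f. \<Sum>(\<alpha>, \<beta>)\<in>S. Poly_Mapping.single \<alpha> (c \<alpha> \<beta>) * partials \<beta> f)"
    using S(1,2)
  proof induction
    case (insert x S)
    obtain \<alpha> \<beta> where x: "x = (\<alpha>, \<beta>)" by (cases x)
    have d: "d = int (expo_deg \<alpha>) - int (expo_deg \<beta>)" using insert.prems x by auto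
    have "?Q (monomial_op \<alpha> \<beta> (c \<alpha> \<beta>))" using mono[OF d] monomial_op_in_component[OF d] by blast
    moreover have "?Q (\<lambda>f. \<Sum>(\<alpha>, \<beta>)\<in>S. Poly_Mapping.single \<alpha> (c \<alpha> \<beta>) * partials \<beta> f)"
      using insert by simp
    ultimately have "?Q (\<lambda>f. monomial_op \<alpha> \<beta> (c \<alpha> \<beta>) f +
        (\<Sum>(\<alpha>, \<beta>)\<in>S. Poly_Mapping.single \<alpha> (c \<alpha> \<beta>) * partials \<beta> f))"
      using add add_in_component by blast
    then show ?case using insert.hyps by (simp add: x monomial_op_def)
  qed (simp add: zero zero_in_component)
  then show ?thesis using S(3) by blast
qed

lemma weyl_component_subset: "a \<in> weyl_component d \<Longrightarrow> a \<in> weyl_carrier"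
  by (induction rule: weyl_component_induct)
    (auto intro: zero_in_weyl_carrier monomial_op_in_weyl_carrier weyl_carrier.add)

lemma partial_const_times: "partial i (const c * f) = const c * partial i f"
proof -
  have "partial i (const c) = 0" by (simp add: const_def partial_single)
  then show ?thesis by (simp add: partial_times)
qed

lemma weyl_scalar_commute:
  assumes "a \<in> weyl_carrier" shows "a (const c * f) = const c * a f"
  using assms
  by (induction arbitrary: f) (auto simp: partial_const_times distrib_left mult.left_commute)

lemma weyl_additive:
  assumes "a \<in> weyl_carrier" shows "a (f + g) = a f + a g"
  using assms
  by (induction arbitrary: f g) (auto simp: partial_add distrib_left algebra_simps)

lemma weyl_at_zero: assumes "a \<in> weyl_carrier" shows "a 0 = 0"
  using weyl_additive[OF assms, of 0 0] by simp

section \<open>The standard transposition\<close>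

lemma diff_op_add_fun: "diff_op (g + h) = (\<lambda>f. diff_op g f + diff_op h f)"
  by (rule ext) (rule diff_op_add)

text \<open>
  The transposition is defined through the normal form, which is additive in the operator; the
  two normal forms have to be summed over a common set of exponents.
\<close>

lemma transposition_add:
  fixes a b :: "('n::finite, 'k::field_char_0) mpoly \<Rightarrow> ('n, 'k) mpoly"
  assumes "a \<in> weyl_carrier" "b \<in> weyl_carrier"
  shows "transposition (\<lambda>f. a f + b f) = (\<lambda>f. transposition a f + transposition b f)"
proof -
  obtain g h where gh: "a = diff_op g" "b = diff_op h"
    using weyl_normal_form assms by blast
  have *: "transposition (diff_op h) f =
      (\<Sum>\<alpha>\<in>S. (-1) ^ expo_deg \<alpha> * partials \<alpha> (Poly_Mapping.lookup h \<alpha> * f))"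
    if "finite S" "Poly_Mapping.keys h \<subseteq> S" for S h and f :: "('n, 'k) mpoly"
    unfolding transposition_diff_op using that
    by (intro sum.mono_neutral_left) (auto simp: in_keys_iff weyl_at_zero[OF partials_in_weyl_carrier])
  let ?S = "Poly_Mapping.keys g \<union> Poly_Mapping.keys h"
  have "Poly_Mapping.keys (g + h) \<subseteq> ?S" by (rule Poly_Mapping.keys_add)
  then show ?thesis
    unfolding gh diff_op_add_fun[symmetric]
    by (simp add: *[of ?S] lookup_add distrib_right weyl_additive[OF partials_in_weyl_carrier]
        sum.distrib distrib_left fun_eq_iff)
qed

lemma transposition_term:
  "transposition (\<lambda>f. g * partials \<beta> f) = (\<lambda>f. (-1) ^ expo_deg \<beta> * partials \<beta> (g * f))"
proof -
  have e: "(\<lambda>f. g * partials \<beta> f) = diff_op (Poly_Mapping.single \<beta> g)"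
    by (simp add: diff_op_single fun_eq_iff)
  show ?thesis
    unfolding e transposition_diff_op
    by (cases "g = 0") (simp_all add: weyl_at_zero[OF partials_in_weyl_carrier])
qed

lemma weyl_times_comp: "a \<in> weyl_carrier \<Longrightarrow> (\<lambda>f. g * a f) \<in> weyl_carrier"
  using weyl_carrier.comp[OF times_in_weyl_carrier] by (simp add: comp_def)

text \<open>
  The first of two generator cases of anti-multiplicativity: left multiplication by a polynomial
  acts on the coefficients of a normal form and leaves its derivations untouched.
\<close>

lemma transposition_times_comp:
  assumes "b \<in> weyl_carrier"
  shows "transposition (\<lambda>f. g * b f) = (\<lambda>f. transposition b (g * f))"
  using assms
proof (induction rule: weyl_carrier_induct)
  case (monomial \<alpha> \<beta> c)
  show ?case
    using transposition_term[of "g * Poly_Mapping.single \<alpha> c" \<beta>]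
    by (simp add: monomial_op_def transposition_term mult.assoc mult.left_commute)
next
  case (add a b)
  show ?case
    using add transposition_add[OF weyl_times_comp weyl_times_comp, of a b g g]
    by (simp add: transposition_add distrib_left)
qed

lemma partials_partial: "partials \<beta> (partial i f) = partial i (partials \<beta> f)"
  by (induction \<beta> rule: expo_induct)
    (simp_all add: partials_Suc[simplified] partial_commute)

lemma weyl_partial_comp: "a \<in> weyl_carrier \<Longrightarrow> (\<lambda>f. partial i (a f)) \<in> weyl_carrier"
  using weyl_carrier.comp[OF weyl_carrier.partial] by (simp add: comp_def)

lemma weyl_uminus: "a \<in> weyl_carrier \<Longrightarrow> a (- f) = - a f"
  using weyl_additive[of a f "- f"] weyl_at_zero[of a] by (simp add: eq_neg_iff_add_eq_0 add.commute)

text \<open>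
  The second generator case.  By the Leibniz rule,
  \<open>\<partial>_i (g \<partial>^\<beta>) = (\<partial>_i g) \<partial>^\<beta> + g \<partial>_i \<partial>^\<beta>\<close>.  In the transposes the two summands carry opposite signs, and
  the terms with \<open>\<partial>_i g\<close> cancel.
\<close>

lemma transposition_partial_comp:
  fixes b :: "('n::finite, 'k::field_char_0) mpoly \<Rightarrow> ('n, 'k) mpoly"
  assumes "b \<in> weyl_carrier"
  shows "transposition (\<lambda>f. partial i (b f)) = (\<lambda>f. transposition b (- partial i f))"
  using assms
proof (induction rule: weyl_carrier_induct)
  case (monomial \<alpha> \<beta> c)
  let ?g = "Poly_Mapping.single \<alpha> c"
  let ?\<beta> = "\<beta> + Poly_Mapping.single i 1"
  have 1: "(\<lambda>f. partial i (monomial_op \<alpha> \<beta> c f)) =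
      (\<lambda>f. partial i ?g * partials \<beta> f + ?g * partials ?\<beta> f)"
    by (simp only: monomial_op_def partial_times partials_Suc)
  have c: "(\<lambda>f. g * partials \<gamma> f) \<in> weyl_carrier" for g :: "('n, 'k) mpoly" and \<gamma>
    by (rule weyl_times_comp[OF partials_in_weyl_carrier])
  have 2: "partials ?\<beta> (?g * f) = partials \<beta> (partial i ?g * f) + partials \<beta> (?g * partial i f)" for f
    by (simp only: partials_Suc partials_partial[symmetric] partial_times
        weyl_additive[OF partials_in_weyl_carrier])
  show ?case
    unfolding 1 transposition_add[OF c c] transposition_term 2 expo_deg_Suc
    unfolding monomial_op_def transposition_term
    by (simp add: weyl_uminus[OF partials_in_weyl_carrier] algebra_simps)
next
  case (add a b)
  show ?case
    using add transposition_add[OF weyl_partial_comp weyl_partial_comp, of a b i i]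
    by (simp add: transposition_add partial_add)
qed

lemma transposition_id: "transposition id = id"
  using transposition_times[of 1] by (simp add: id_def)

text \<open>
  Both sides are compatible with sums and products in \<open>a\<close>, so it is enough that the identity holds,
  for all \<open>b\<close> at once, when \<open>a\<close> is a generator.
\<close>

lemma transposition_comp:
  assumes "a \<in> weyl_carrier" "b \<in> weyl_carrier"
  shows "transposition (a \<circ> b) = transposition b \<circ> transposition a"
  using assms
proof (induction arbitrary: b)
  case (const c)
  then show ?case by (simp add: comp_def transposition_times_comp transposition_times)
next
  case (var i)
  then show ?case by (simp add: comp_def transposition_times_comp transposition_times)
next
  case (partial i)
  then show ?case by (simp add: comp_def transposition_partial_comp transposition_partial)
next
  case (add a1 a2)
  have "(\<lambda>f. a1 f + a2 f) \<circ> b = (\<lambda>f. (a1 \<circ> b) f + (a2 \<circ> b) f)" by auto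
  moreover have "transposition b (f + g) = transposition b f + transposition b g" for f g
  proof -
    obtain h where "b = diff_op h" using weyl_normal_form[OF add.prems] by blast
    then show ?thesis
      by (simp add: transposition_diff_op distrib_left weyl_additive[OF partials_in_weyl_carrier] sum.distrib)
  qed
  ultimately show ?case
    using add transposition_add[OF weyl_carrier.comp[OF add.hyps(1) add.prems] weyl_carrier.comp[OF add.hyps(2) add.prems]]
    by (simp add: transposition_add comp_def)
next
  case (comp a1 a2)
  have "transposition (a1 \<circ> a2 \<circ> b) = transposition (a2 \<circ> b) \<circ> transposition a1"
    unfolding comp_assoc by (rule comp.IH(1)) (intro weyl_carrier.comp comp)
  also have "\<dots> = transposition b \<circ> (transposition a2 \<circ> transposition a1)"
    by (simp only: comp.IH(2)[OF comp.prems] comp_assoc)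
  finally show ?case by (simp only: comp.IH(1)[OF comp.hyps(2)])
qed

lemma uminus_in_component: "a \<in> weyl_component d \<Longrightarrow> (\<lambda>f. - a f) \<in> weyl_component d"
proof (induction rule: weyl_component_induct)
  case (monomial \<alpha> \<beta> c)
  have "(\<lambda>f. - monomial_op \<alpha> \<beta> c f) = monomial_op \<alpha> \<beta> (- c)"
    by (simp add: monomial_op_def single_uminus)
  then show ?case using monomial_op_in_component[OF monomial, of "- c"] by simp
next
  case (add a b)
  from add_in_component[OF add(3,4)] show ?case by simp
qed (simp add: zero_in_component)

text \<open>
  Again the Leibniz rule.  If \<open>X_i\<close> does not occur in the coefficient, the truncated subtraction
  leaves a monomial of the wrong degree, but its coefficient is then \<open>0\<close>.
\<close>

lemma partial_comp_in_component:
  assumes "a \<in> weyl_component d" shows "(\<lambda>f. partial i (a f)) \<in> weyl_component (d - 1)"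
  using assms
proof (induction rule: weyl_component_induct)
  case (monomial \<alpha> \<beta> c)
  have 1: "(\<lambda>f. partial i (monomial_op \<alpha> \<beta> c f)) =
      (\<lambda>f. monomial_op (\<alpha> - Poly_Mapping.single i 1) \<beta> (of_nat (Poly_Mapping.lookup \<alpha> i) * c) f
         + monomial_op \<alpha> (\<beta> + Poly_Mapping.single i 1) c f)"
    by (simp only: monomial_op_def partial_times partials_Suc partial_single)
  have 2: "monomial_op (\<alpha> - Poly_Mapping.single i 1) \<beta> (of_nat (Poly_Mapping.lookup \<alpha> i) * c)
      \<in> weyl_component (d - 1)"
  proof (cases "Poly_Mapping.lookup \<alpha> i = 0")
    case True
    then show ?thesis using zero_in_component by (simp add: monomial_op_def)
  next
    case False
    then have "\<alpha> = (\<alpha> - Poly_Mapping.single i 1) + Poly_Mapping.single i 1"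
      by (intro poly_mapping_eqI) (auto simp: lookup_add lookup_minus lookup_single when_def)
    then have "expo_deg \<alpha> = Suc (expo_deg (\<alpha> - Poly_Mapping.single i 1))"
      by (metis expo_deg_Suc)
    then show ?thesis by (intro monomial_op_in_component) (simp add: monomial)
  qed
  show ?case
    unfolding 1 by (intro add_in_component 2 monomial_op_in_component) (simp add: monomial del: One_nat_def)
next
  case (add a b)
  from add_in_component[OF add(3,4)] show ?case by (simp add: partial_add)
qed (simp add: zero_in_component)

lemma partials_comp_in_component:
  assumes "a \<in> weyl_component d"
  shows "(\<lambda>f. partials \<beta> (a f)) \<in> weyl_component (d - int (expo_deg \<beta>))"
proof (induction \<beta> rule: expo_induct)
  case (Suc \<beta> i)
  from partial_comp_in_component[OF this, of i] show ?case
    by (simp add: partials_Suc diff_diff_eq add.commute del: One_nat_def)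
qed (simp add: assms)

lemma transposition_zero: "transposition (\<lambda>f. 0) = (\<lambda>f. 0)"
  using transposition_times[of 0] by simp

text \<open>
  The transpose \<open>\<plusminus>\<partial>^\<beta> c X^\<alpha>\<close> of a monomial is not in normal form, but it arises from the
  homogeneous operator \<open>c X^\<alpha>\<close> by applying \<open>|\<beta>|\<close> derivations, each of degree \<open>-1\<close>.
\<close>

lemma transposition_in_component:
  assumes "a \<in> weyl_component d" shows "transposition a \<in> weyl_component d"
  using assms
proof (induction rule: weyl_component_induct)
  case zero
  show ?case by (simp add: transposition_zero zero_in_component)
next
  case (monomial \<alpha> \<beta> c)
  have "(\<lambda>f. Poly_Mapping.single \<alpha> c * f) \<in> weyl_component (int (expo_deg \<alpha>))"
    using monomial_op_in_component[of "int (expo_deg \<alpha>)" \<alpha> 0 c] by (simp add: monomial_op_def)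
  from partials_comp_in_component[OF this, of \<beta>]
  have *: "(\<lambda>f. partials \<beta> (Poly_Mapping.single \<alpha> c * f)) \<in> weyl_component d" by (simp add: monomial)
  then show ?case
    using uminus_in_component[OF *]
    by (cases "even (expo_deg \<beta>)") (simp_all add: monomial_op_def transposition_term)
next
  case (add a b)
  then show ?case
    using add_in_component[OF add(3,4)] by (simp add: transposition_add weyl_component_subset)
qed

lemma transposition_in_weyl_carrier:
  assumes "a \<in> weyl_carrier" shows "transposition a \<in> weyl_carrier"
  using assms
proof (induction rule: weyl_carrier_induct)
  case (monomial \<alpha> \<beta> c)
  show ?case
    by (rule weyl_component_subset, rule transposition_in_component, rule monomial_op_in_component, rule refl)
next
  case (add a b)
  then show ?case by (simp add: transposition_add weyl_carrier.add)
qed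

section \<open>Graded modules and their shifts\<close>

lemma weyl_simps [simp]:
  "carrier weyl = weyl_carrier" "a \<otimes>\<^bsub>weyl\<^esub> b = a \<circ> b" "\<one>\<^bsub>weyl\<^esub> = id"
  "\<zero>\<^bsub>weyl\<^esub> = (\<lambda>f. 0)" "a \<oplus>\<^bsub>weyl\<^esub> b = (\<lambda>f. a f + b f)"
  by (simp_all add: weyl_def)

lemma scalar_in_weyl_carrier: "scalar c \<in> weyl_carrier"
  unfolding scalar_def by (rule weyl_carrier.const)

lemma weyl_comp_scalar: "a \<in> weyl_carrier \<Longrightarrow> a \<circ> scalar c = scalar c \<circ> a"
  by (auto simp: scalar_def weyl_scalar_commute)

context graded_weyl_module
begin

lemma component_in_carrier: "x \<in> component M i \<Longrightarrow> x \<in> carrier M"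
  using additive_subgroup.a_subset[OF component_subgroup] by blast

lemma smult_zero_right: "a \<in> weyl_carrier \<Longrightarrow> a \<odot>\<^bsub>M\<^esub> \<zero>\<^bsub>M\<^esub> = \<zero>\<^bsub>M\<^esub>"
proof -
  assume a: "a \<in> weyl_carrier"
  have "a \<odot>\<^bsub>M\<^esub> (\<zero>\<^bsub>M\<^esub> \<oplus>\<^bsub>M\<^esub> \<zero>\<^bsub>M\<^esub>) = a \<odot>\<^bsub>M\<^esub> \<zero>\<^bsub>M\<^esub> \<oplus>\<^bsub>M\<^esub> a \<odot>\<^bsub>M\<^esub> \<zero>\<^bsub>M\<^esub>"
    using a by (intro smult_r_distr) auto
  then show ?thesis
    using smult_closed[of a "\<zero>\<^bsub>M\<^esub>"] a by simp
qed

lemma K_linear_zero: "K_linear M \<phi> \<Longrightarrow> \<phi> \<zero>\<^bsub>M\<^esub> = 0"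
proof -
  assume "K_linear M \<phi>"
  then have "\<phi> (\<zero>\<^bsub>M\<^esub> \<oplus>\<^bsub>M\<^esub> \<zero>\<^bsub>M\<^esub>) = \<phi> \<zero>\<^bsub>M\<^esub> + \<phi> \<zero>\<^bsub>M\<^esub>"
    unfolding K_linear_def using M.zero_closed by blast
  then show ?thesis by simp
qed

lemma K_linear_finsum:
  assumes "K_linear M \<phi>" "finite S" "\<And>i. i \<in> S \<Longrightarrow> c i \<in> carrier M"
  shows "\<phi> (\<Oplus>\<^bsub>M\<^esub>i\<in>S. c i) = (\<Sum>i\<in>S. \<phi> (c i))"
  using assms(2,3)
proof induction
  case (insert x S)
  then have "(\<Oplus>\<^bsub>M\<^esub>i\<in>S. c i) \<in> carrier M" by (intro M.finsum_closed) auto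
  with insert show ?case
    using assms(1) by (simp add: M.finsum_insert K_linear_def Pi_def)
qed (simp add: K_linear_zero[OF assms(1)])

text \<open>
  This is how equations between functionals on a graded module get proved, since the components
  span the module.
\<close>

lemma K_linear_eqI:
  assumes "K_linear M \<phi>" "K_linear M \<psi>"
    and "\<And>j x. x \<in> component M j \<Longrightarrow> \<phi> x = \<psi> x"
  shows "\<phi> = \<psi>"
proof
  fix x
  show "\<phi> x = \<psi> x"
  proof (cases "x \<in> carrier M")
    case True
    from direct_sum[OF True] obtain c where c: "\<And>i. c i \<in> component M i"
      "finite {i. c i \<noteq> \<zero>\<^bsub>M\<^esub>}" "x = (\<Oplus>\<^bsub>M\<^esub>i\<in>{i. c i \<noteq> \<zero>\<^bsub>M\<^esub>}. c i)" by blast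
    have eval: "\<chi> x = (\<Sum>i\<in>{i. c i \<noteq> \<zero>\<^bsub>M\<^esub>}. \<chi> (c i))" if "K_linear M \<chi>" for \<chi>
      by (subst c(3), rule K_linear_finsum[OF that c(2) component_in_carrier[OF c(1)]])
    show ?thesis using assms(3)[OF c(1)] by (simp add: eval assms(1,2))
  next
    case False
    then show ?thesis using assms(1,2) by (simp add: K_linear_def)
  qed
qed

text \<open>
  Only the direct sum decomposition needs an argument: a decomposition with respect to one grading
  becomes one for the other after translating the index.
\<close>

lemma graded_weyl_module_shift: "graded_weyl_module (shift k M)"
proof -
  have sums: "finsum (shift k M) = (finsum M :: (int \<Rightarrow> 'm) \<Rightarrow> _)"
    by (simp add: fun_eq_iff finsum_def shift_def)
  have mod: "left_module weyl (shift k M)"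
  proof -
    have "abelian_group (shift k M)"
      using M.abelian_group_axioms
      by (simp add: shift_def abelian_group_def abelian_monoid_def abelian_group_axioms_def)
    moreover have "left_module_axioms weyl (shift k M)"
      using left_module_axioms by (simp add: left_module_def left_module_axioms_def shift_def)
    ultimately show ?thesis using R.ring_axioms by (simp add: left_module_def)
  qed
  show ?thesis
  proof (intro graded_weyl_module.intro[OF mod] graded_weyl_module_axioms.intro)
    show "additive_subgroup (component (shift k M) i) (shift k M)" for i
      using component_subgroup[of "k + i"] by (simp add: shift_def additive_subgroup_def)
  next
    fix x assume "x \<in> carrier (shift k M)"
    then have x: "x \<in> carrier M" by (simp add: shift_def)
    have reindex: "(\<Oplus>\<^bsub>M\<^esub>i\<in>{i. c i \<noteq> \<zero>\<^bsub>M\<^esub>}. c i)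
        = (\<Oplus>\<^bsub>M\<^esub>i\<in>{i. c (i + l) \<noteq> \<zero>\<^bsub>M\<^esub>}. c (i + l))"
      "finite {i. c (i + l) \<noteq> \<zero>\<^bsub>M\<^esub>} \<longleftrightarrow> finite {i. c i \<noteq> \<zero>\<^bsub>M\<^esub>}"
      if "\<And>i. c i \<in> carrier M" for c :: "int \<Rightarrow> 'm" and l
    proof -
      have im: "{i. c i \<noteq> \<zero>\<^bsub>M\<^esub>} = (\<lambda>i. i + l) ` {i. c (i + l) \<noteq> \<zero>\<^bsub>M\<^esub>}"
        by (auto intro!: image_eqI[of _ _ "_ - l"])
      show "(\<Oplus>\<^bsub>M\<^esub>i\<in>{i. c i \<noteq> \<zero>\<^bsub>M\<^esub>}. c i) = (\<Oplus>\<^bsub>M\<^esub>i\<in>{i. c (i + l) \<noteq> \<zero>\<^bsub>M\<^esub>}. c (i + l))"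
        by (subst im, subst M.finsum_reindex) (use that in auto)
      show "finite {i. c (i + l) \<noteq> \<zero>\<^bsub>M\<^esub>} \<longleftrightarrow> finite {i. c i \<noteq> \<zero>\<^bsub>M\<^esub>}"
        unfolding im by (simp add: finite_image_iff)
    qed
    let ?P = "\<lambda>N c. (\<forall>i. c i \<in> component N i) \<and> finite {i. c i \<noteq> \<zero>\<^bsub>M\<^esub>} \<and>
      x = (\<Oplus>\<^bsub>M\<^esub>i\<in>{i. c i \<noteq> \<zero>\<^bsub>M\<^esub>}. c i)"
    from direct_sum[OF x] obtain c where c: "?P M c" and uniq: "\<And>c'. ?P M c' \<Longrightarrow> c' = c" by blast
    have "\<exists>!c. ?P (shift k M) c"
    proof (rule ex1I[of _ "\<lambda>i. c (i + k)"])
      show "?P (shift k M) (\<lambda>i. c (i + k))"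
        using c reindex[of c k] component_in_carrier by (auto simp: shift_def add.commute)
    next
      fix c' assume c': "?P (shift k M) c'"
      then have comp: "c' i \<in> component M (k + i)" for i by (simp add: shift_def)
      have "c' (i + (- k)) \<in> component M i" for i using comp[of "i - k"] by simp
      then have "?P M (\<lambda>i. c' (i + (- k)))"
        using c' reindex[of c' "- k"] component_in_carrier[OF comp] by auto
      from uniq[OF this] have "(\<lambda>i. c' (i + (- k))) = c" .
      then show "c' = (\<lambda>i. c (i + k))" by auto
    qed
    then show "\<exists>!c. (\<forall>i. c i \<in> component (shift k M) i) \<and> finite {i. c i \<noteq> \<zero>\<^bsub>shift k M\<^esub>} \<and>
        x = (\<Oplus>\<^bsub>shift k M\<^esub>i\<in>{i. c i \<noteq> \<zero>\<^bsub>shift k M\<^esub>}. c i)"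
      unfolding sums by (simp add: shift_def)
  next
    fix a :: "('n, 'k) mpoly \<Rightarrow> ('n, 'k) mpoly" and d x i
    assume "a \<in> weyl_component d" "x \<in> component (shift k M) i"
    then show "a \<odot>\<^bsub>shift k M\<^esub> x \<in> component (shift k M) (d + i)"
      using smult_component[of a d x "k + i"] by (simp add: shift_def add.left_commute)
  qed
qed

section \<open>The graded dual\<close>

abbreviation "D \<equiv> graded_dual M"

lemma dual_simps [simp]:
  "\<zero>\<^bsub>D\<^esub> = (\<lambda>x. 0)" "\<phi> \<oplus>\<^bsub>D\<^esub> \<psi> = (\<lambda>x. \<phi> x + \<psi> x)" "component D = dual_component M"
  by (simp_all add: graded_dual_def)

text \<open>
  Kept out of the simplifier, so that \<open>a \<odot> \<phi>\<close> stays folded until it is evaluated.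
\<close>

lemma dual_smult: "a \<odot>\<^bsub>D\<^esub> \<phi> = (\<lambda>x. if x \<in> carrier M then \<phi> (transposition a \<odot>\<^bsub>M\<^esub> x) else 0)"
  by (simp_all add: graded_dual_def)

lemma dual_component_K_linear: "\<phi> \<in> dual_component M i \<Longrightarrow> K_linear M \<phi>"
  by (simp add: dual_component_def)

lemma zero_in_dual_component: "(\<lambda>x. 0) \<in> dual_component M i"
  by (simp add: dual_component_def K_linear_def)

lemma add_in_dual_component:
  "\<phi> \<in> dual_component M i \<Longrightarrow> \<psi> \<in> dual_component M i \<Longrightarrow> (\<lambda>x. \<phi> x + \<psi> x) \<in> dual_component M i"
  by (auto simp: dual_component_def K_linear_def algebra_simps)

lemma uminus_in_dual_component: "\<phi> \<in> dual_component M i \<Longrightarrow> (\<lambda>x. - \<phi> x) \<in> dual_component M i"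
  by (auto simp: dual_component_def K_linear_def)

lemma dual_component_in_carrier: "\<phi> \<in> dual_component M i \<Longrightarrow> \<phi> \<in> carrier D"
  by (auto simp: graded_dual_def intro!: exI[of _ "{i}"] exI[of _ "\<lambda>_. \<phi>"])

lemma dual_carrierE:
  assumes "\<phi> \<in> carrier D"
  obtains I p where "finite I" "\<And>i. i \<in> I \<Longrightarrow> p i \<in> dual_component M i"
    "\<phi> = (\<lambda>x. \<Sum>i\<in>I. p i x)"
  using assms unfolding graded_dual_def partial_object.simps by blast

lemma zero_in_dual: "(\<lambda>x. 0) \<in> carrier D"
  by (rule dual_component_in_carrier[OF zero_in_dual_component])

lemma add_in_dual:
  assumes \<phi>: "\<phi> \<in> carrier D" and \<psi>: "\<psi> \<in> carrier D"
  shows "(\<lambda>x. \<phi> x + \<psi> x) \<in> carrier D"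
proof -
  from \<phi> obtain I p where
    p: "finite I" "\<And>i. i \<in> I \<Longrightarrow> p i \<in> dual_component M i" "\<phi> = (\<lambda>x. \<Sum>i\<in>I. p i x)"
    by (rule dual_carrierE) (rule that)
  from \<psi> obtain J q where
    q: "finite J" "\<And>i. i \<in> J \<Longrightarrow> q i \<in> dual_component M i" "\<psi> = (\<lambda>x. \<Sum>i\<in>J. q i x)"
    by (rule dual_carrierE) (rule that)
  let ?p = "\<lambda>i x. if i \<in> I then p i x else 0" and ?q = "\<lambda>i x. if i \<in> J then q i x else 0"
  have "?p i \<in> dual_component M i" "?q i \<in> dual_component M i" for i
    by (cases "i \<in> I"; cases "i \<in> J"; simp add: p q zero_in_dual_component)+
  then have *: "(\<lambda>x. ?p i x + ?q i x) \<in> dual_component M i" for i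
    by (intro add_in_dual_component)
  have "\<phi> x = (\<Sum>i\<in>I \<union> J. ?p i x)" for x
    unfolding p(3) using p(1) q(1) by (intro sum.mono_neutral_cong_left) auto
  moreover have "\<psi> x = (\<Sum>i\<in>I \<union> J. ?q i x)" for x
    unfolding q(3) using p(1) q(1) by (intro sum.mono_neutral_cong_left) auto
  ultimately have "(\<lambda>x. \<phi> x + \<psi> x) = (\<lambda>x. \<Sum>i\<in>I \<union> J. ?p i x + ?q i x)"
    by (simp only: sum.distrib)
  then show ?thesis
    unfolding graded_dual_def partial_object.simps
    using p(1) q(1) *
    by (intro CollectI exI[of _ "I \<union> J"] exI[of _ "\<lambda>i x. ?p i x + ?q i x"]) auto
qed

text \<open>
  Additive statements about the dual need checking only on functionals supported in one degree.
\<close>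

lemma dual_induct [consumes 1, case_names homogeneous add]:
  assumes "\<phi> \<in> carrier D"
    and hom: "\<And>i \<phi>. \<phi> \<in> dual_component M i \<Longrightarrow> P \<phi>"
    and add: "\<And>\<phi> \<psi>. P \<phi> \<Longrightarrow> P \<psi> \<Longrightarrow> P (\<lambda>x. \<phi> x + \<psi> x)"
  shows "P \<phi>"
proof -
  from assms(1) obtain I p where
    p: "finite I" "\<And>i. i \<in> I \<Longrightarrow> p i \<in> dual_component M i" "\<phi> = (\<lambda>x. \<Sum>i\<in>I. p i x)"
    by (rule dual_carrierE) (rule that)
  have "P (\<lambda>x. \<Sum>i\<in>I. p i x)"
    using p(1,2)
  proof induction
    case empty
    show ?case using hom[OF zero_in_dual_component] by simp
  next
    case (insert i I)
    then have "P (p i)" "P (\<lambda>x. \<Sum>i\<in>I. p i x)" by (auto intro: hom)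
    from add[OF this] show ?case using insert.hyps by simp
  qed
  then show ?thesis by (simp add: p(3))
qed

lemma dual_K_linear: "\<phi> \<in> carrier D \<Longrightarrow> K_linear M \<phi>"
proof (induction rule: dual_induct)
  case (add \<phi> \<psi>)
  then show ?case by (auto simp: K_linear_def algebra_simps)
qed (rule dual_component_K_linear)

lemma uminus_in_dual: "\<phi> \<in> carrier D \<Longrightarrow> (\<lambda>x. - \<phi> x) \<in> carrier D"
proof (induction rule: dual_induct)
  case (homogeneous i \<phi>)
  then show ?case by (intro dual_component_in_carrier[OF uminus_in_dual_component])
next
  case (add \<phi> \<psi>)
  from add_in_dual[OF this] show ?case by simp
qed

lemma dual_abelian_group: "abelian_group D"
proof (rule abelian_groupI)
  fix \<phi> assume "\<phi> \<in> carrier D"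
  then show "\<exists>\<psi>\<in>carrier D. \<psi> \<oplus>\<^bsub>D\<^esub> \<phi> = \<zero>\<^bsub>D\<^esub>"
    by (intro bexI[of _ "\<lambda>x. - \<phi> x"] uminus_in_dual) auto
qed (auto simp: add_in_dual zero_in_dual algebra_simps)

lemma dual_a_inv: "\<phi> \<in> carrier D \<Longrightarrow> \<ominus>\<^bsub>D\<^esub> \<phi> = (\<lambda>x. - \<phi> x)"
  by (rule abelian_group.minus_equality[OF dual_abelian_group]) (auto simp: uminus_in_dual)

lemma dual_finsum:
  assumes "finite S" "\<And>i. i \<in> S \<Longrightarrow> c i \<in> carrier D"
  shows "(\<Oplus>\<^bsub>D\<^esub>i\<in>S. c i) = (\<lambda>x. \<Sum>i\<in>S. c i x)"
proof -
  interpret D: abelian_group D by (rule dual_abelian_group)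
  show ?thesis using assms
    by (induction rule: finite_induct) (simp_all add: D.finsum_insert Pi_def)
qed

text \<open>
  The \<open>K\<close>-linearity of \<open>a \<odot> \<phi>\<close> rests on the scalars being central in the Weyl algebra.
\<close>

lemma K_linear_smult:
  assumes "K_linear M \<phi>" "a \<in> weyl_carrier"
  shows "K_linear M (a \<odot>\<^bsub>D\<^esub> \<phi>)"
proof -
  let ?t = "transposition a"
  have t: "?t \<in> weyl_carrier" by (rule transposition_in_weyl_carrier[OF assms(2)])
  have comm: "?t \<circ> scalar c = scalar c \<circ> ?t" for c
    by (rule weyl_comp_scalar[OF t])
  have "?t \<odot>\<^bsub>M\<^esub> (scalar c \<odot>\<^bsub>M\<^esub> x) = scalar c \<odot>\<^bsub>M\<^esub> (?t \<odot>\<^bsub>M\<^esub> x)" if "x \<in> carrier M" for c x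
    using smult_assoc[of ?t "scalar c" x] smult_assoc[of "scalar c" ?t x] t that
    by (simp add: comm scalar_in_weyl_carrier)
  moreover have "?t \<odot>\<^bsub>M\<^esub> x \<in> carrier M" "scalar c \<odot>\<^bsub>M\<^esub> x \<in> carrier M" if "x \<in> carrier M" for c x
    using t that by (auto intro!: smult_closed simp: scalar_in_weyl_carrier)
  ultimately show ?thesis
    using assms(1) t by (simp add: K_linear_def smult_r_distr dual_smult)
qed

text \<open>
  The transpose of \<open>a\<close> raises degrees by \<open>d\<close>, so \<open>a \<odot> \<phi>\<close> can be nonzero only on the component
  that is moved into degree \<open>-i\<close>, which is the one of degree \<open>-(d + i)\<close>.
\<close>

lemma smult_in_dual_component:
  assumes "a \<in> weyl_component d" "\<phi> \<in> dual_component M i"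
  shows "a \<odot>\<^bsub>D\<^esub> \<phi> \<in> dual_component M (d + i)"
proof -
  have "\<phi> (transposition a \<odot>\<^bsub>M\<^esub> x) = 0" if "j \<noteq> - (d + i)" "x \<in> component M j" for j x
  proof -
    have "transposition a \<odot>\<^bsub>M\<^esub> x \<in> component M (d + j)"
      by (rule smult_component[OF transposition_in_component[OF assms(1)] that(2)])
    moreover have "d + j \<noteq> - i" using that(1) by auto
    ultimately show ?thesis using assms(2) by (auto simp: dual_component_def)
  qed
  then show ?thesis
    using K_linear_smult[OF dual_component_K_linear[OF assms(2)] weyl_component_subset[OF assms(1)]]
    by (auto simp: dual_component_def dual_smult)
qed

lemma dual_smult_add_left:
  assumes "a \<in> weyl_carrier" "b \<in> weyl_carrier" "K_linear M \<phi>"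
  shows "(\<lambda>f. a f + b f) \<odot>\<^bsub>D\<^esub> \<phi> = (\<lambda>x. (a \<odot>\<^bsub>D\<^esub> \<phi>) x + (b \<odot>\<^bsub>D\<^esub> \<phi>) x)"
proof -
  have t: "transposition a \<in> weyl_carrier" "transposition b \<in> weyl_carrier"
    using assms(1,2) by (auto intro: transposition_in_weyl_carrier)
  have "transposition (\<lambda>f. a f + b f) \<odot>\<^bsub>M\<^esub> x =
      transposition a \<odot>\<^bsub>M\<^esub> x \<oplus>\<^bsub>M\<^esub> transposition b \<odot>\<^bsub>M\<^esub> x" if "x \<in> carrier M" for x
    using smult_l_distr[of "transposition a" "transposition b" x] t that assms(1,2)
    by (simp add: transposition_add)
  then show ?thesis
    using t assms(3) smult_closed by (auto simp: K_linear_def dual_smult)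
qed

text \<open>
  The carrier consists of finite sums of homogeneous functionals, and closure is not visible for
  an inhomogeneous operator; splitting both the functional and the operator into homogeneous parts
  reduces it to the graded statement.
\<close>

lemma dual_smult_closed:
  assumes "a \<in> weyl_carrier" "\<phi> \<in> carrier D"
  shows "a \<odot>\<^bsub>D\<^esub> \<phi> \<in> carrier D"
  using assms(2)
proof (induction rule: dual_induct)
  case (homogeneous i \<phi>)
  show ?case using assms(1)
  proof (induction rule: weyl_carrier_induct)
    case (monomial \<alpha> \<beta> c)
    show ?case
      by (rule dual_component_in_carrier, rule smult_in_dual_component[OF monomial_op_in_component[OF refl] homogeneous])
  next
    case (add a b)
    show ?case
      unfolding dual_smult_add_left[OF add(1,2) dual_component_K_linear[OF homogeneous]]
      by (rule add_in_dual[OF add(3,4)])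
  qed
next
  case (add \<phi> \<psi>)
  have "a \<odot>\<^bsub>D\<^esub> (\<lambda>x. \<phi> x + \<psi> x) = (\<lambda>x. (a \<odot>\<^bsub>D\<^esub> \<phi>) x + (a \<odot>\<^bsub>D\<^esub> \<psi>) x)"
    by (auto simp: dual_smult)
  then show ?case using add_in_dual[OF add] by simp
qed

text \<open>
  The associativity law uses that the transposition reverses products, which turns the right action
  on functionals by precomposition into a left action.
\<close>

lemma dual_left_module: "left_module weyl D"
proof (intro left_module.intro[OF ring_weyl dual_abelian_group] left_module_axioms.intro)
  show "a \<odot>\<^bsub>D\<^esub> \<phi> \<in> carrier D" if "a \<in> carrier weyl" "\<phi> \<in> carrier D" for a \<phi>
    using that by (intro dual_smult_closed) auto
  show "(a \<oplus>\<^bsub>weyl\<^esub> b) \<odot>\<^bsub>D\<^esub> \<phi> = a \<odot>\<^bsub>D\<^esub> \<phi> \<oplus>\<^bsub>D\<^esub> b \<odot>\<^bsub>D\<^esub> \<phi>"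
    if "a \<in> carrier weyl" "b \<in> carrier weyl" "\<phi> \<in> carrier D" for a b \<phi>
    using dual_smult_add_left[of a b \<phi>] dual_K_linear[OF that(3)] that by simp
  show "a \<odot>\<^bsub>D\<^esub> (\<phi> \<oplus>\<^bsub>D\<^esub> \<psi>) = a \<odot>\<^bsub>D\<^esub> \<phi> \<oplus>\<^bsub>D\<^esub> a \<odot>\<^bsub>D\<^esub> \<psi>" for a \<phi> \<psi>
    by (auto simp: dual_smult)
  show "(a \<otimes>\<^bsub>weyl\<^esub> b) \<odot>\<^bsub>D\<^esub> \<phi> = a \<odot>\<^bsub>D\<^esub> (b \<odot>\<^bsub>D\<^esub> \<phi>)"
    if ab: "a \<in> carrier weyl" "b \<in> carrier weyl" for a b \<phi>
  proof -
    have t: "transposition a \<in> weyl_carrier" "transposition b \<in> weyl_carrier"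
      using ab by (auto intro: transposition_in_weyl_carrier)
    then show ?thesis
      using ab smult_closed[of "transposition a"] smult_assoc[of "transposition b" "transposition a"]
      by (auto simp: transposition_comp dual_smult)
  qed
  show "\<one>\<^bsub>weyl\<^esub> \<odot>\<^bsub>D\<^esub> \<phi> = \<phi>" if "\<phi> \<in> carrier D" for \<phi>
  proof
    fix x
    have "\<phi> x = 0" if "x \<notin> carrier M"
      using dual_K_linear[OF \<open>\<phi> \<in> carrier D\<close>] that unfolding K_linear_def by blast
    then show "(\<one>\<^bsub>weyl\<^esub> \<odot>\<^bsub>D\<^esub> \<phi>) x = \<phi> x"
      using smult_one[of x] by (simp add: dual_smult transposition_id)
  qed
qed

lemma dual_component_subgroup: "additive_subgroup (dual_component M i) D"
proof (intro additive_subgroupI subgroup.intro)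
  show "dual_component M i \<subseteq> carrier (add_monoid D)"
    using dual_component_in_carrier by auto
  show "inv\<^bsub>add_monoid D\<^esub> \<phi> \<in> dual_component M i" if "\<phi> \<in> dual_component M i" for \<phi>
    using dual_a_inv[OF dual_component_in_carrier[OF that]] uminus_in_dual_component[OF that]
    unfolding a_inv_def by (simp only:)
  show "\<phi> \<otimes>\<^bsub>add_monoid D\<^esub> \<psi> \<in> dual_component M i"
    if "\<phi> \<in> dual_component M i" "\<psi> \<in> dual_component M i" for \<phi> \<psi>
    using add_in_dual_component[OF that] by simp
  show "\<one>\<^bsub>add_monoid D\<^esub> \<in> dual_component M i"
    using zero_in_dual_component by simp
qed

text \<open>
  The component of degree \<open>i\<close> of \<open>\<phi>\<close> is forced: it has the values of \<open>\<phi>\<close> in degree \<open>-i\<close> and vanishes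
  in all other degrees.
\<close>

lemma dual_direct_sum:
  assumes "\<phi> \<in> carrier D"
  shows "\<exists>!c. (\<forall>i. c i \<in> dual_component M i) \<and> finite {i. c i \<noteq> (\<lambda>x. 0)} \<and>
    \<phi> = (\<Oplus>\<^bsub>D\<^esub>i\<in>{i. c i \<noteq> (\<lambda>x. 0)}. c i)"
proof -
  from assms obtain I p where
    p: "finite I" "\<And>i. i \<in> I \<Longrightarrow> p i \<in> dual_component M i" "\<phi> = (\<lambda>x. \<Sum>i\<in>I. p i x)"
    by (rule dual_carrierE) (rule that)
  define c where "c = (\<lambda>i. if i \<in> I then p i else (\<lambda>x. 0))"
  have c: "c i \<in> dual_component M i" for i by (simp add: c_def p(2) zero_in_dual_component)
  have sub: "{i. c i \<noteq> (\<lambda>x. 0)} \<subseteq> I" by (auto simp: c_def)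
  then have fin: "finite {i. c i \<noteq> (\<lambda>x. 0)}" using p(1) by (rule finite_subset)
  have "(\<Oplus>\<^bsub>D\<^esub>i\<in>{i. c i \<noteq> (\<lambda>x. 0)}. c i) = (\<lambda>x. \<Sum>i\<in>{i. c i \<noteq> (\<lambda>x. 0)}. c i x)"
    using fin dual_component_in_carrier[OF c] by (intro dual_finsum)
  also have "\<dots> = \<phi>"
    unfolding p(3) using p(1) sub by (intro ext sum.mono_neutral_cong_left) (auto simp: c_def)
  finally have sum: "\<phi> = (\<Oplus>\<^bsub>D\<^esub>i\<in>{i. c i \<noteq> (\<lambda>x. 0)}. c i)" ..
  have val: "\<phi> x = e i x" if e: "\<forall>i. e i \<in> dual_component M i" "finite {i. e i \<noteq> (\<lambda>x. 0)}"
      "\<phi> = (\<Oplus>\<^bsub>D\<^esub>i\<in>{i. e i \<noteq> (\<lambda>x. 0)}. e i)" and x: "x \<in> component M (- i)" for e i x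
  proof -
    have z: "e j x = 0" if "j \<noteq> i" for j
    proof -
      have "e j \<in> dual_component M j" "- i \<noteq> - j" using e(1) that by auto
      then show ?thesis using x unfolding dual_component_def by blast
    qed
    have "\<phi> x = (\<Sum>j\<in>{i. e i \<noteq> (\<lambda>x. 0)}. e j x)"
      by (subst e(3), subst dual_finsum[OF e(2)]) (use e(1) dual_component_in_carrier in auto)
    also have "\<dots> = (\<Sum>j\<in>insert i {i. e i \<noteq> (\<lambda>x. 0)}. e j x)"
      using e(2) by (intro sum.mono_neutral_left) auto
    also have "\<dots> = (\<Sum>j\<in>{i}. e j x)"
      using e(2) z by (intro sum.mono_neutral_right) auto
    finally show ?thesis by simp
  qed
  show ?thesis
  proof (rule ex1I[of _ c])
    show "(\<forall>i. c i \<in> dual_component M i) \<and> finite {i. c i \<noteq> (\<lambda>x. 0)} \<and>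
        \<phi> = (\<Oplus>\<^bsub>D\<^esub>i\<in>{i. c i \<noteq> (\<lambda>x. 0)}. c i)" using c fin sum by blast
  next
    fix e assume e: "(\<forall>i. e i \<in> dual_component M i) \<and> finite {i. e i \<noteq> (\<lambda>x. 0)} \<and>
        \<phi> = (\<Oplus>\<^bsub>D\<^esub>i\<in>{i. e i \<noteq> (\<lambda>x. 0)}. e i)"
    show "e = c"
    proof
      fix i
      have ei: "e i \<in> dual_component M i" using e by blast
      show "e i = c i"
      proof (rule K_linear_eqI)
        fix j x assume x: "x \<in> component M j"
        show "e i x = c i x"
        proof (cases "j = - i")
          case True
          then show ?thesis using val[of e x i] val[of c x i] e c fin sum x by auto
        next
          case False
          then show ?thesis using ei c[of i] x by (simp add: dual_component_def)
        qed
      qed (use ei c[of i] in \<open>auto intro: dual_component_K_linear\<close>)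
    qed
  qed
qed

lemma graded_weyl_module_dual: "graded_weyl_module D"
proof (intro graded_weyl_module.intro[OF dual_left_module] graded_weyl_module_axioms.intro)
  show "additive_subgroup (component D i) D" for i
    unfolding dual_simps by (rule dual_component_subgroup)
  show "\<exists>!c. (\<forall>i. c i \<in> component D i) \<and> finite {i. c i \<noteq> \<zero>\<^bsub>D\<^esub>} \<and>
      \<phi> = (\<Oplus>\<^bsub>D\<^esub>i\<in>{i. c i \<noteq> \<zero>\<^bsub>D\<^esub>}. c i)" if "\<phi> \<in> carrier D" for \<phi>
    unfolding dual_simps using that by (rule dual_direct_sum)
  show "a \<odot>\<^bsub>D\<^esub> \<phi> \<in> component D (d + i)"
    if "a \<in> weyl_component d" "\<phi> \<in> component D i" for a d \<phi> i
    using that unfolding dual_simps by (rule smult_in_dual_component)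
qed

end

section \<open>The Euler operator\<close>

lemma weyl_a_inv: "a \<in> weyl_carrier \<Longrightarrow> \<ominus>\<^bsub>weyl\<^esub> a = (\<lambda>f. - a f)"
proof -
  assume a: "a \<in> weyl_carrier"
  interpret W: ring weyl by (rule ring_weyl)
  have "(\<lambda>f. - a f) \<in> weyl_carrier"
    using weyl_times_comp[OF a, of "- 1"] by simp
  then show ?thesis using a by (intro W.minus_equality) auto
qed

lemma weyl_pow_closed:
  assumes "b \<in> weyl_carrier" shows "b [^]\<^bsub>weyl\<^esub> (k::nat) \<in> weyl_carrier"
proof -
  interpret W: ring weyl by (rule ring_weyl)
  show ?thesis using W.nat_pow_closed[of b k] assms by simp
qed

lemma euler_minus_scalar:
  "euler \<ominus>\<^bsub>weyl\<^esub> scalar c = (\<lambda>f :: ('n::finite, 'k::field_char_0) mpoly. euler f + scalar (- c) f)"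
proof -
  have "const (- c) = (- const c :: ('n, 'k) mpoly)" by (simp add: const_def single_uminus)
  then show ?thesis
    by (simp add: a_minus_def weyl_a_inv scalar_in_weyl_carrier) (simp add: scalar_def)
qed

lemma partials_single_1: "partials (Poly_Mapping.single i 1) f = partial i f"
  using partials_Suc[of 0 i f] by simp

lemma euler_in_component: "euler \<in> weyl_component 0"
proof -
  have "(\<lambda>f. \<Sum>i\<in>S. var i * partial i f) \<in> weyl_component 0" if "finite S" for S
    using that
  proof induction
    case (insert i S)
    have "monomial_op (Poly_Mapping.single i 1) (Poly_Mapping.single i 1) 1 \<in> weyl_component 0"
      by (rule monomial_op_in_component) simp
    then have "(\<lambda>f. var i * partial i f) \<in> weyl_component 0"
      by (simp only: monomial_op_def partials_single_1 var_def)
    from add_in_component[OF this insert.IH] show ?case using insert.hyps by simp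
  qed (simp add: zero_in_component)
  then show ?thesis by (simp add: euler_def)
qed

lemma scalar_in_component: "scalar c \<in> weyl_component 0"
  using monomial_op_in_component[of 0 0 0 c] by (simp add: monomial_op_def scalar_def const_def)

lemma euler_minus_scalar_in_component: "euler \<ominus>\<^bsub>weyl\<^esub> scalar c \<in> weyl_component 0"
  unfolding euler_minus_scalar by (intro add_in_component euler_in_component scalar_in_component)

lemma partial_var: "partial i (var i) = 1"
  by (simp add: var_def partial_single)

text \<open>
  The transpose of \<open>X_i \<partial>_i\<close> is \<open>- \<partial>_i X_i = - X_i \<partial>_i - 1\<close>.  Summing the constants \<open>-1\<close> over the variables
  produces the \<open>-n\<close> that the shift by \<open>-n\<close> compensates.
\<close>

lemma transposition_euler:
  "transposition euler = (\<lambda>f :: ('n::finite, 'k::field_char_0) mpoly. - euler f - of_nat CARD('n) * f)"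
proof -
  have *: "transposition (\<lambda>f. \<Sum>i\<in>S. var i * partial i f) =
      (\<lambda>f :: ('n, 'k) mpoly. \<Sum>i\<in>S. - f - var i * partial i f)"
    and **: "(\<lambda>f :: ('n, 'k) mpoly. \<Sum>i\<in>S. var i * partial i f) \<in> weyl_carrier"
    if "finite S" for S
    using that
  proof induction
    case empty
    { case 1 show ?case by (simp add: transposition_zero) next
      case 2 show ?case by (simp add: zero_in_weyl_carrier) }
  next
    case (insert i S)
    have t: "(\<lambda>f :: ('n, 'k) mpoly. var i * partial i f) \<in> weyl_carrier"
      by (rule weyl_times_comp[OF weyl_carrier.partial])
    { case 1
      have "transposition (\<lambda>f. var i * partial i f) = (\<lambda>f :: ('n, 'k) mpoly. - f - var i * partial i f)"
        by (simp add: transposition_times_comp weyl_carrier.partial transposition_partial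
            partial_times partial_var)
      then show ?case
        using transposition_add[OF t insert.IH(2)] insert.IH(1) insert.hyps by simp
    next
      case 2
      show ?case using weyl_carrier.add[OF t insert.IH(2)] insert.hyps by simp }
  qed
  show ?thesis
    unfolding euler_def *[OF finite_class.finite_UNIV] by (simp add: sum_subtractf sum_negf fun_eq_iff algebra_simps)
qed

lemma transposition_euler_minus_scalar:
  "transposition (euler \<ominus>\<^bsub>weyl\<^esub> scalar (of_int d)) = scalar (- 1) \<circ>
     (euler \<ominus>\<^bsub>weyl\<^esub> scalar (of_int (- int CARD('n) - d)) ::
      ('n::finite, 'k::field_char_0) mpoly \<Rightarrow> ('n, 'k) mpoly)"
proof -
  have c: "const (of_nat m) = (of_nat m :: ('n, 'k) mpoly)" for m
    unfolding const_def by (induction m) (simp_all add: single_add)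
  have m: "const (- c) = (- const c :: ('n, 'k) mpoly)" "const (b + c) = (const b + const c :: ('n, 'k) mpoly)"
    "const (b - c) = (const b - const c :: ('n, 'k) mpoly)" "const 1 = (1 :: ('n, 'k) mpoly)"for b c
    by (simp_all add: const_def single_uminus single_add single_diff)
  show ?thesis
    unfolding euler_minus_scalar
      transposition_add[OF weyl_component_subset[OF euler_in_component] scalar_in_weyl_carrier]
      transposition_euler
    unfolding scalar_def transposition_times
    by (auto simp: m c algebra_simps)
qed

text \<open>
  The sign splits off as a power of \<open>-1\<close> because scalars are central.
\<close>

lemma transposition_euler_power:
  "transposition ((euler \<ominus>\<^bsub>weyl\<^esub> scalar (of_int d)) [^]\<^bsub>weyl\<^esub> (a::nat)) = scalar ((- 1) ^ a) \<circ>
     ((euler \<ominus>\<^bsub>weyl\<^esub> scalar (of_int (- int CARD('n) - d))) [^]\<^bsub>weyl\<^esub> a ::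
      ('n::finite, 'k::field_char_0) mpoly \<Rightarrow> ('n, 'k) mpoly)"
proof -
  interpret W: ring "weyl :: (('n, 'k) mpoly \<Rightarrow> ('n, 'k) mpoly) ring" by (rule ring_weyl)
  let ?u = "euler \<ominus>\<^bsub>weyl\<^esub> scalar (of_int d) :: ('n, 'k) mpoly \<Rightarrow> ('n, 'k) mpoly"
  let ?v = "euler \<ominus>\<^bsub>weyl\<^esub> scalar (of_int (- int CARD('n) - d)) :: ('n, 'k) mpoly \<Rightarrow> ('n, 'k) mpoly"
  have u: "?u \<in> weyl_carrier" and v: "?v \<in> weyl_carrier"
    by (rule weyl_component_subset[OF euler_minus_scalar_in_component])+
  show ?thesis
  proof (induction a)
    case 0
    show ?case
      by (simp only: W.nat_pow_0 weyl_simps transposition_id power_0)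
        (simp add: scalar_def const_def fun_eq_iff)
  next
    case (Suc a)
    have "transposition (?u [^]\<^bsub>weyl\<^esub> Suc a) = transposition ?u \<circ> transposition (?u [^]\<^bsub>weyl\<^esub> a)"
      using transposition_comp[OF weyl_pow_closed[OF u] u] by simp
    also have "\<dots> = scalar (- 1) \<circ> (?v \<circ> scalar ((- 1) ^ a)) \<circ> ?v [^]\<^bsub>weyl\<^esub> a"
      by (simp only: Suc.IH transposition_euler_minus_scalar comp_assoc)
    also have "?v \<circ> scalar ((- 1) ^ a) = scalar ((- 1) ^ a) \<circ> ?v"
      by (rule weyl_comp_scalar[OF v])
    also have "scalar (- 1) \<circ> (scalar ((- 1) ^ a) \<circ> ?v) \<circ> ?v [^]\<^bsub>weyl\<^esub> a
        = (scalar (- 1) \<circ> scalar ((- 1) ^ a)) \<circ> (?v \<circ> ?v [^]\<^bsub>weyl\<^esub> a)"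
      by (simp only: comp_assoc)
    also have "scalar (- 1) \<circ> scalar ((- 1) ^ a) = (scalar ((- 1) ^ Suc a) :: ('n, 'k) mpoly \<Rightarrow> _)"
      by (auto simp: scalar_def const_def mult_single simp flip: mult.assoc)
    also have "?v \<circ> ?v [^]\<^bsub>weyl\<^esub> a = ?v [^]\<^bsub>weyl\<^esub> Suc a"
      using W.nat_pow_Suc2[of ?v a] v by simp
    finally show ?case .
  qed
qed

theorem theorem1p6:
  fixes M :: "('n::finite, 'k::field_char_0, 'm) weyl_module"
  assumes "strongly_generalized_eulerian M"
  shows "strongly_generalized_eulerian (graded_dual (shift (- int CARD('n)) M))"
proof -
  from assms obtain a :: nat where M: "graded_weyl_module M" and a: "a > 0"
    and nil: "\<And>d w. w \<in> component M d \<Longrightarrow> w \<noteq> \<zero>\<^bsub>M\<^esub> \<Longrightarrow>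
      ((euler \<ominus>\<^bsub>weyl\<^esub> scalar (of_int d)) [^]\<^bsub>weyl\<^esub> a) \<odot>\<^bsub>M\<^esub> w = \<zero>\<^bsub>M\<^esub>"
    unfolding strongly_generalized_eulerian_def by blast
  let ?N = "shift (- int CARD('n)) M"
  interpret W: ring "weyl :: (('n, 'k) mpoly \<Rightarrow> ('n, 'k) mpoly) ring" by (rule ring_weyl)
  interpret N: graded_weyl_module ?N
    by (rule graded_weyl_module.graded_weyl_module_shift[OF M])
  interpret D: graded_weyl_module "graded_dual ?N"
    by (rule N.graded_weyl_module_dual)
  have "((euler \<ominus>\<^bsub>weyl\<^esub> scalar (of_int d)) [^]\<^bsub>weyl\<^esub> a) \<odot>\<^bsub>graded_dual ?N\<^esub> \<phi> = \<zero>\<^bsub>graded_dual ?N\<^esub>"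
    if \<phi>: "\<phi> \<in> dual_component ?N d" for d \<phi>
  proof -
    let ?u = "euler \<ominus>\<^bsub>weyl\<^esub> scalar (of_int d) :: ('n, 'k) mpoly \<Rightarrow> ('n, 'k) mpoly"
    let ?v = "euler \<ominus>\<^bsub>weyl\<^esub> scalar (of_int (- int CARD('n) - d)) :: ('n, 'k) mpoly \<Rightarrow> ('n, 'k) mpoly"
    have u0: "?u \<in> weyl_component 0" and u: "?u \<in> weyl_carrier" and v: "?v \<in> weyl_carrier"
      using euler_minus_scalar_in_component weyl_component_subset by blast+
    \<comment> \<open>\<open>?u\<close> has degree 0, so its powers keep \<open>\<phi>\<close> in degree \<open>d\<close>, and only the values in degree \<open>-d\<close>
      remain to be computed.\<close>
    have hom: "(?u [^]\<^bsub>weyl\<^esub> k) \<odot>\<^bsub>graded_dual ?N\<^esub> \<phi> \<in> dual_component ?N d" for k :: nat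
    proof (induction k)
      case 0
      show ?case
        using D.smult_one[OF N.dual_component_in_carrier[OF \<phi>]] \<phi> W.nat_pow_0[of ?u] by metis
    next
      case (Suc k)
      have eq: "(?u [^]\<^bsub>weyl\<^esub> Suc k) \<odot>\<^bsub>graded_dual ?N\<^esub> \<phi> =
          ?u \<odot>\<^bsub>graded_dual ?N\<^esub> ((?u [^]\<^bsub>weyl\<^esub> k) \<odot>\<^bsub>graded_dual ?N\<^esub> \<phi>)"
        using D.smult_assoc[of ?u "?u [^]\<^bsub>weyl\<^esub> k" \<phi>] W.nat_pow_Suc2[of ?u k] u weyl_pow_closed[OF u]
          N.dual_component_in_carrier[OF \<phi>] by simp
      show ?case unfolding eq using N.smult_in_dual_component[OF u0 Suc] by simp
    qed
    have lin: "K_linear ?N \<phi>" by (rule N.dual_component_K_linear[OF \<phi>])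
    show ?thesis
    proof (rule N.K_linear_eqI)
      show "K_linear ?N ((?u [^]\<^bsub>weyl\<^esub> a) \<odot>\<^bsub>graded_dual ?N\<^esub> \<phi>)"
        by (rule N.dual_component_K_linear[OF hom])
      show "K_linear ?N \<zero>\<^bsub>graded_dual ?N\<^esub>"
        using N.dual_component_K_linear[OF N.zero_in_dual_component] by simp
      fix j x assume x: "x \<in> component ?N j"
      then have xN: "x \<in> carrier ?N" by (rule N.component_in_carrier)
      show "((?u [^]\<^bsub>weyl\<^esub> a) \<odot>\<^bsub>graded_dual ?N\<^esub> \<phi>) x = \<zero>\<^bsub>graded_dual ?N\<^esub> x"
      proof (cases "j = - d")
        case False
        then show ?thesis using hom[of a] x by (simp add: dual_component_def)
      next
        case True
        have "x \<in> component M (- int CARD('n) + j)" using x by (simp add: shift_def)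
        then have xM: "x \<in> component M (- int CARD('n) - d)"
          by (simp only: True diff_conv_add_uminus)
        \<comment> \<open>The Eulerian hypothesis speaks of nonzero elements only.\<close>
        have "(?v [^]\<^bsub>weyl\<^esub> a) \<odot>\<^bsub>?N\<^esub> x = \<zero>\<^bsub>?N\<^esub>"
        proof (cases "x = \<zero>\<^bsub>?N\<^esub>")
          case True
          then show ?thesis using N.smult_zero_right[OF weyl_pow_closed[OF v]] by simp
        next
          case False
          then show ?thesis using nil[OF xM] by (simp add: shift_def)
        qed
        then have "transposition (?u [^]\<^bsub>weyl\<^esub> a) \<odot>\<^bsub>?N\<^esub> x = \<zero>\<^bsub>?N\<^esub>"
          using N.smult_assoc[of "scalar ((- 1) ^ a)" "?v [^]\<^bsub>weyl\<^esub> a" x] weyl_pow_closed[OF v] xN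
          by (simp add: transposition_euler_power[of d a] N.smult_zero_right scalar_in_weyl_carrier)
        then show ?thesis using N.K_linear_zero[OF lin] by (simp add: N.dual_smult)
      qed
    qed
  qed
  then show ?thesis
    unfolding strongly_generalized_eulerian_def
    using N.graded_weyl_module_dual a by (intro conjI exI[of _ a]) auto
qed

end
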